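(* Let $P_1,\dots,P_N$ be discrete probability measures on $\mathbb{R}^d$, let $\lambda_1,\dots,\lambda_N>0$ with $\sum_{i=1}^N\lambda_i=1$, and let $\bar P$ be a barycenter of $P_1,\dots,P_N$. Let Algorithm 2 (described in the context) be run on an approximate barycenter $\bar P_{\text{org}}$ in $S_{\text{org}}=\bigcup_{i=1}^N\operatorname{supp}(P_i)$ and an optimal transport for it, as returned by Algorithm 1 (described in the context). Then Algorithm 2 returns a measure $\bar P'$ supported on a subset of $$S=\Big\{\sum_{i=1}^N\lambda_ix_i:\ x_i\in\operatorname{supp}(P_i)\Big\}$$ with $\phi(\bar P')\le 2\cdot\phi(\bar P)$, and there is a non-mass splitting transport from $\bar P'$ to $P_1,\dots,P_N$ realizing this bound (i.e., of cost at most $2\cdot\phi(\bar P)$). Further, $$|\bar P'|\le\Big(\sum_{i=1}^N|P_i|-N+1\Big)^2 .$$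
   Context: **Basic notions.** A discrete probability measure is a probability measure with finite support. Write $\operatorname{supp}(P_i)=\{x_{ik}:k=1,\dots,|P_i|\}$, where $|P_i|$ is the number of support points (similarly $|P|$ for any discrete measure $P$), and let $d_{ik}>0$ be the mass of $x_{ik}$ in $P_i$. $W_2$ is the quadratic Wasserstein distance (Euclidean ground norm), $\phi(P)=\sum_{i=1}^N\lambda_iW_2(P,P_i)^2$, and a barycenter $\bar P$ is a minimizer of $\phi$ over all probability measures on $\mathbb{R}^d$ with finite second moments. For a finite set $S_0\subset\mathbb{R}^d$, an approximate barycenter in $S_0$ is a probability measure supported in $S_0$ that minimizes $\phi$ among all probability measures supported in $S_0$. **Transports.** A transport from a discrete probability measure $P_0$ (support points $x_j$ with masses $d_j$) to $P_1,\dots,P_N$ is a family $y=(y_{ijk})$, $y_{ijk}\ge0$, with $\sum_k y_{ijk}=d_j$ for all $i,j$ and $\sum_jy_{ijk}=d_{ik}$ for all $i,k$. Its cost is $\sum_i\lambda_i\sum_j\sum_k\|x_j-x_{ik}\|^2y_{ijk}$; it is optimal if its cost is minimal, in which case the cost equals $\phi(P_0)$. It is non-mass splitting if for all support points $x_j$ of $P_0$ and all $i$ there is exactly one $k$ with $y_{ijk}=d_j$, while $y_{ijk'}=0$ for all $k'\ne k$. **Algorithm 1** (for a finite set $S_0=\{x_1,\dots,x_{|S_0|}\}$ of possible support points; here $S_0=S_{\text{org}}$). Compute an optimal vertex $(z,y)$ of the linear program: minimize $\sum_{i=1}^N\lambda_i\sum_{j=1}^{|S_0|}\sum_{k=1}^{|P_i|}\|x_j-x_{ik}\|^2y_{ijk}$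 subject to $\sum_{k}y_{ijk}=z_j$ for all $i,j$; $\sum_jy_{ijk}=d_{ik}$ for all $i,k$; $y_{ijk}\ge0$; $z_j\in\mathbb{R}$. Return the measure $\bar P_{\text{org}}$ with mass $z_j$ on $x_j$, and its optimal transport $y$. **Algorithm 2.** Input: $P_1,\dots,P_N$, $\lambda$, and the output $\bar P_{\text{org}}$, $(z,y)$ of Algorithm 1. *Step 1.* Let $\operatorname{supp}(\bar P_{\text{org}})=\{s_1,\dots,s_r\}=\{x_{t_1},\dots,x_{t_r}\}$ with masses $d_l=z_{t_l}>0$. For each $l\le r$, $i\le N$, let $P_i^l$ be the partial measure consisting of those $x_{ik}$ with $y_{it_lk}>0$, with mass $y_{it_lk}$. Index its support points as $x^l_{i1},\dots,x^l_{i|P_i^l|}$ with masses $d^l_{i1},\dots,d^l_{i|P_i^l|}$. *Step 2.* For $l=r$ descending to $1$, for $j=1$ ascending to $l-1$ (while $d_l>0$): (a) For each $i\le N$ choose an index $q_i\in\arg\max_{q\le|P_i^l|}(s_j-s_l)^Tx^l_{iq}$, and let $c=\sum_{i=1}^N\lambda_ix^l_{iq_i}$. (b) If $\|c-s_j\|^2=\|c-s_l\|^2$, then: let $d_{\min}=\min_{i\le N}d^l_{iq_i}$; decrease $d_l$ and all $d^l_{iq_i}$ ($i\le N$) by $d_{\min}$; remove $x^l_{iq_i}$ from $P_i^l$ if its mass has become $0$ (and reindex); for each $i\le N$ add the point $x^l_{iq_i}$ to $\operatorname{supp}(P_i^j)$ (with initial mass $0$) if not already present, and increase its mass in $P_i^j$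 by $d_{\min}$; increase $d_j$ by $d_{\min}$; if $d_l>0$, go back to (a) for the same $l,j$. (Otherwise, continue with the next $j$.) *Step 3.* For $l=1$ ascending to $r$: create an empty partial measure $\bar P^l$, and while $d_l>0$ repeat: (a) for each $i\le N$ let $x^l_{iq_i}$ be the lexicographically maximal support point of $P_i^l$ (largest first coordinate, among those largest second coordinate, and so on); let $c=\sum_{i=1}^N\lambda_ix^l_{iq_i}$; (b) let $d_{\min}=\min_{i\le N}d^l_{iq_i}$; decrease $d_l$ and all $d^l_{iq_i}$ by $d_{\min}$; remove $x^l_{iq_i}$ from $P_i^l$ if its mass has become $0$ (and reindex); add $c$ to $\operatorname{supp}(\bar P^l)$ with mass $d_{\min}$. *Step 4.* Return $\bar P'=\sum_{l=1}^r\bar P^l$. *)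

theory Defs
  imports "HOL-Probability.Probability" "HOL-Analysis.Finite_Function_Topology"
begin

section \<open>Wasserstein distance and barycenters\<close>

definition couplings ::
  "'a::second_countable_topology measure \<Rightarrow> 'a measure \<Rightarrow> ('a \<times> 'a) measure set"
where
  "couplings M N =
     {\<pi>. sets \<pi> = sets (borel \<Otimes>\<^sub>M borel) \<and> distr \<pi> borel fst = M \<and> distr \<pi> borel snd = N}"

text \<open>
  The infimum is finite for probability measures with finite second moments, the only case in which
  \<open>W2\<close> is used below; the conversion to the reals is harmless there.
\<close>

definition W2 :: "'a::euclidean_space measure \<Rightarrow> 'a measure \<Rightarrow> real" where
  "W2 M N = sqrt (enn2real (INF \<pi>\<in>couplings M N. \<integral>\<^sup>+z. ennreal ((norm (fst z - snd z))\<^sup>2) \<partial>\<pi>))"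

definition finite_second_moment_measures :: "'a::euclidean_space measure set" where
  "finite_second_moment_measures =
     {M. prob_space M \<and> sets M = sets borel \<and> integrable M (\<lambda>x. (norm x)\<^sup>2)}"

text \<open>
  Discrete probability measures are represented as \<^typ>\<open>'a pmf\<close> with finite \<^const>\<open>set_pmf\<close>. The measure
  \<^const>\<open>measure_pmf\<close> lives on the power set, hence the transfer to the Borel sets.
\<close>

definition borel_pmf :: "'a::euclidean_space pmf \<Rightarrow> 'a measure" where
  "borel_pmf p = distr (measure_pmf p) borel (\<lambda>x. x)"

definition phi ::
  "('n::finite \<Rightarrow> 'a::euclidean_space pmf) \<Rightarrow> ('n \<Rightarrow> real) \<Rightarrow> 'a measure \<Rightarrow> real"
where
  "phi P lam M = (\<Sum>i\<in>UNIV. lam i * (W2 M (borel_pmf (P i)))\<^sup>2)"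

definition barycenter ::
  "('n::finite \<Rightarrow> 'a::euclidean_space pmf) \<Rightarrow> ('n \<Rightarrow> real) \<Rightarrow> 'a measure \<Rightarrow> bool"
where
  "barycenter P lam M \<longleftrightarrow>
     M \<in> finite_second_moment_measures \<and>
     (\<forall>Q\<in>finite_second_moment_measures. phi P lam M \<le> phi P lam Q)"


section \<open>Transports\<close>

text \<open>
  The entry \<open>y i x w\<close> is the mass sent from the point \<open>x\<close> to the support point \<open>w\<close> of \<open>P i\<close>:
  support points are used directly as indices.
\<close>

definition transport ::
  "'a pmf \<Rightarrow> ('n \<Rightarrow> 'a pmf) \<Rightarrow> ('n \<Rightarrow> 'a \<Rightarrow> 'a \<Rightarrow> real) \<Rightarrow> bool"
where
  "transport P0 P y \<longleftrightarrow>
     (\<forall>i. \<forall>x\<in>set_pmf P0. \<forall>w\<in>set_pmf (P i). 0 \<le> y i x w) \<and>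
     (\<forall>i. \<forall>x\<in>set_pmf P0. (\<Sum>w\<in>set_pmf (P i). y i x w) = pmf P0 x) \<and>
     (\<forall>i. \<forall>w\<in>set_pmf (P i). (\<Sum>x\<in>set_pmf P0. y i x w) = pmf (P i) w)"

definition transport_cost ::
  "'a::euclidean_space set \<Rightarrow> ('n::finite \<Rightarrow> 'a pmf) \<Rightarrow> ('n \<Rightarrow> real) \<Rightarrow> ('n \<Rightarrow> 'a \<Rightarrow> 'a \<Rightarrow> real) \<Rightarrow> real"
where
  "transport_cost X P lam y =
     (\<Sum>i\<in>UNIV. lam i * (\<Sum>x\<in>X. \<Sum>w\<in>set_pmf (P i). (norm (x - w))\<^sup>2 * y i x w))"

definition non_mass_splitting ::
  "'a pmf \<Rightarrow> ('n \<Rightarrow> 'a pmf) \<Rightarrow> ('n \<Rightarrow> 'a \<Rightarrow> 'a \<Rightarrow> real) \<Rightarrow> bool"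
where
  "non_mass_splitting P0 P y \<longleftrightarrow>
     (\<forall>x\<in>set_pmf P0. \<forall>i. \<exists>!w. w \<in> set_pmf (P i) \<and> y i x w = pmf P0 x \<and>
        (\<forall>w'\<in>set_pmf (P i). w' \<noteq> w \<longrightarrow> y i x w' = 0))"

definition S_org :: "('n \<Rightarrow> 'a pmf) \<Rightarrow> 'a set" where
  "S_org P = (\<Union>i. set_pmf (P i))"

definition weighted_mean :: "('n::finite \<Rightarrow> real) \<Rightarrow> ('n \<Rightarrow> 'a::real_vector) \<Rightarrow> 'a" where
  "weighted_mean lam q = (\<Sum>i\<in>UNIV. lam i *\<^sub>R q i)"

definition S_centers :: "('n::finite \<Rightarrow> 'a::real_vector pmf) \<Rightarrow> ('n \<Rightarrow> real) \<Rightarrow> 'a set" where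
  "S_centers P lam = {weighted_mean lam x |x. \<forall>i. x i \<in> set_pmf (P i)}"


section \<open>Algorithm 1\<close>

text \<open>
  The variables of the linear program are finitely supported functions, so that the library notion
  of an extreme point applies; the first two conditions confine them to the actual index sets.
\<close>

definition lp_feasible ::
  "'a set \<Rightarrow> ('n \<Rightarrow> 'a pmf) \<Rightarrow> (('a \<Rightarrow>\<^sub>0 real) \<times> ('n \<times> 'a \<times> 'a \<Rightarrow>\<^sub>0 real)) set"
where
  "lp_feasible S0 P = {(z, y).
     Poly_Mapping.keys z \<subseteq> S0 \<and>
     Poly_Mapping.keys y \<subseteq> {(i, x, w). x \<in> S0 \<and> w \<in> set_pmf (P i)} \<and>
     (\<forall>i. \<forall>x\<in>S0. (\<Sum>w\<in>set_pmf (P i). Poly_Mapping.lookup y (i, x, w)) = Poly_Mapping.lookup z x) \<and>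
     (\<forall>i. \<forall>w\<in>set_pmf (P i). (\<Sum>x\<in>S0. Poly_Mapping.lookup y (i, x, w)) = pmf (P i) w) \<and>
     (\<forall>i. \<forall>x\<in>S0. \<forall>w\<in>set_pmf (P i). 0 \<le> Poly_Mapping.lookup y (i, x, w))}"

definition lp_cost ::
  "'a::euclidean_space set \<Rightarrow> ('n::finite \<Rightarrow> 'a pmf) \<Rightarrow> ('n \<Rightarrow> real) \<Rightarrow> ('n \<times> 'a \<times> 'a \<Rightarrow>\<^sub>0 real) \<Rightarrow> real"
where
  "lp_cost S0 P lam y = transport_cost S0 P lam (\<lambda>i x w. Poly_Mapping.lookup y (i, x, w))"

definition algorithm1_output ::
  "'a::euclidean_space set \<Rightarrow> ('n::finite \<Rightarrow> 'a pmf) \<Rightarrow> ('n \<Rightarrow> real) \<Rightarrow>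
   'a pmf \<Rightarrow> ('n \<times> 'a \<times> 'a \<Rightarrow>\<^sub>0 real) \<Rightarrow> bool"
where
  "algorithm1_output S0 P lam Porg y \<longleftrightarrow>
     (\<exists>z. (z, y) extreme_point_of lp_feasible S0 P \<and>
          (\<forall>(z', y')\<in>lp_feasible S0 P. lp_cost S0 P lam y \<le> lp_cost S0 P lam y') \<and>
          (\<forall>x. pmf Porg x = Poly_Mapping.lookup z x))"


section \<open>Algorithm 2\<close>

text \<open>
  A partial measure is given by its mass function \<open>m\<close>; its support consists of the points of positive
  mass. In particular, removing a point whose mass has become 0, or inserting a new point with
  initial mass 0, needs no separate bookkeeping.
\<close>

definition msupp :: "('a \<Rightarrow> real) \<Rightarrow> 'a set" where
  "msupp m = {x. 0 < m x}"

definition add_mass :: "('n \<Rightarrow> 'a \<Rightarrow> real) \<Rightarrow> ('n \<Rightarrow> 'a) \<Rightarrow> real \<Rightarrow> 'n \<Rightarrow> 'a \<Rightarrow> real" where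
  "add_mass p q t = (\<lambda>i x. if x = q i then p i x + t else p i x)"

definition d_min :: "('n::finite \<Rightarrow> 'a \<Rightarrow> real) \<Rightarrow> ('n \<Rightarrow> 'a) \<Rightarrow> real" where
  "d_min p q = Min (range (\<lambda>i. p i (q i)))"

type_synonym 'd point = "(real, 'd) vec"

text \<open>The linear order on the index type is the order of the coordinates.\<close>

definition lex_less :: "'d::{finite,linorder} point \<Rightarrow> 'd point \<Rightarrow> bool" where
  "lex_less x y \<longleftrightarrow> (\<exists>k. (\<forall>j<k. x $ j = y $ j) \<and> x $ k < y $ k)"

definition lex_max :: "'d::{finite,linorder} point set \<Rightarrow> 'd point \<Rightarrow> bool" where
  "lex_max A x \<longleftrightarrow> x \<in> A \<and> (\<forall>y\<in>A. y \<noteq> x \<longrightarrow> lex_less y x)"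

text \<open>
  The choice of maximizers in step 2 is not determined, so the algorithm is a transition relation.
  A configuration records the position in the program, the masses \<open>d l\<close>, and the partial measures
  \<open>p l i\<close> (written \<open>P\<^sub>i\<^sup>l\<close> in the pseudocode).
  \<^item> \<open>Merging l j d p\<close>: step 2 is about to test the loop condition for \<open>(l, j)\<close>.
  \<^item> \<open>Splitting l d p B\<close>: step 3 is about to test the loop condition for \<open>l\<close>; \<open>B k\<close> is the partial
    measure created so far from the \<open>k\<close>-th point.
  \<^item> \<open>Returned m\<close>: the algorithm has stopped with the measure with mass function \<open>m\<close>.
\<close>

datatype ('n, 'a) config =
    Merging nat nat "nat \<Rightarrow> real" "nat \<Rightarrow> 'n \<Rightarrow> 'a \<Rightarrow> real"
  | Splitting nat "nat \<Rightarrow> real" "nat \<Rightarrow> 'n \<Rightarrow> 'a \<Rightarrow> real" "nat \<Rightarrow> 'a \<Rightarrow> real"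
  | Returned "'a \<Rightarrow> real"

inductive algorithm2_step ::
  "('n::finite \<Rightarrow> real) \<Rightarrow> (nat \<Rightarrow> 'd::{finite,linorder} point) \<Rightarrow> nat \<Rightarrow>
   ('n, 'd point) config \<Rightarrow> ('n, 'd point) config \<Rightarrow> bool"
  for lam :: "'n \<Rightarrow> real" and s :: "nat \<Rightarrow> 'd point" and r :: nat
where
  merge:
    "\<lbrakk>1 \<le> l; j < l; 0 < d l;
      \<And>i. is_arg_max (\<lambda>x. (s j - s l) \<bullet> x) (\<lambda>x. x \<in> msupp (p l i)) (q i);
      c = weighted_mean lam q;
      (norm (c - s j))\<^sup>2 = (norm (c - s l))\<^sup>2;
      t = d_min (p l) q\<rbrakk>
     \<Longrightarrow> algorithm2_step lam s r
           (Merging l j d p)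
           (Merging l j (d(l := d l - t, j := d j + t))
              (p(l := add_mass (p l) q (- t), j := add_mass (p j) q t)))"
| merge_skip:
    "\<lbrakk>1 \<le> l; j < l; 0 < d l;
      \<And>i. is_arg_max (\<lambda>x. (s j - s l) \<bullet> x) (\<lambda>x. x \<in> msupp (p l i)) (q i);
      c = weighted_mean lam q;
      (norm (c - s j))\<^sup>2 \<noteq> (norm (c - s l))\<^sup>2\<rbrakk>
     \<Longrightarrow> algorithm2_step lam s r (Merging l j d p) (Merging l (j + 1) d p)"
| merge_next:
    "\<lbrakk>1 \<le> l; \<not> (j < l \<and> 0 < d l)\<rbrakk>
     \<Longrightarrow> algorithm2_step lam s r (Merging l j d p) (Merging (l - 1) 1 d p)"
| merge_done:
    "algorithm2_step lam s r (Merging 0 j d p) (Splitting 1 d p (\<lambda>_ _. 0))"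
| split:
    "\<lbrakk>l \<le> r; 0 < d l;
      \<And>i. lex_max (msupp (p l i)) (q i);
      c = weighted_mean lam q;
      t = d_min (p l) q\<rbrakk>
     \<Longrightarrow> algorithm2_step lam s r
           (Splitting l d p B)
           (Splitting l (d(l := d l - t)) (p(l := add_mass (p l) q (- t)))
              (B(l := (B l)(c := B l c + t))))"
| split_next:
    "\<lbrakk>l \<le> r; \<not> 0 < d l\<rbrakk>
     \<Longrightarrow> algorithm2_step lam s r (Splitting l d p B) (Splitting (l + 1) d p B)"
| split_done:
    "r < l \<Longrightarrow> algorithm2_step lam s r (Splitting l d p B) (Returned (\<lambda>x. \<Sum>k=1..r. B k x))"

definition algorithm2_start ::
  "(nat \<Rightarrow> 'a) \<Rightarrow> nat \<Rightarrow> 'a pmf \<Rightarrow> ('n \<times> 'a \<times> 'a \<Rightarrow>\<^sub>0 real) \<Rightarrow> ('n, 'a) config"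
where
  "algorithm2_start s r Porg y =
     Merging r 1 (\<lambda>l. pmf Porg (s l)) (\<lambda>l i x. Poly_Mapping.lookup y (i, s l, x))"

end

theory Submission
  imports Defs
begin

text \<open>
  Gluing almost optimal couplings of a measure \<open>M\<close> with \<open>P\<^sub>1, \<dots>, P\<^sub>N\<close> along \<open>M\<close> shows that moving the
  glued mass to the \<open>k\<close>-th coordinate costs, averaged over \<open>k\<close> with the weights \<open>\<lambda>\<^sub>k\<close>, at most twice as
  much as moving it to \<open>M\<close>. Hence the optimal value of the linear program is at most \<open>2 \<phi>(M)\<close>.

  Merging keeps the transport optimal. By optimality, the weighted mean of a tuple of points served
  by \<open>s\<^sub>l\<close> is never closer to another \<open>s\<^sub>j\<close> than to \<open>s\<^sub>l\<close>, and after merging it is strictly closer to \<open>s\<^sub>l\<close>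
  for \<open>j < l\<close>. So means belonging to different \<open>l\<close> differ. For a fixed \<open>l\<close> the split tuples decrease
  lexicographically, hence so do their means. Every mean therefore comes from a single tuple, which
  gives the transport without mass splitting, and replacing \<open>s\<^sub>l\<close> by the mean does not increase the
  cost. Each split exhausts a support point and the last one exhausts \<open>N\<close> of them, while a vertex of
  the linear program has at most \<open>\<Sum>\<^sub>i |P\<^sub>i| - N + 1\<close> support points.
\<close>

section \<open>Vertices of the linear program\<close>

text \<open>The constant 2 comes from the variance identity: for weights of total 1, the weighted
  double sum of the squared mutual distances is twice the variance, and the variance is at most the
  mean squared distance to any point \<open>x\<close>. Since every P_k lives on
  \<open>S_org P\<close>, a plan starting at P_k is itself a candidate for the linear program, so
  the optimum lies below the weighted average of these N candidates. The obstacle in the second half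
  is ties. Optimality alone allows a mean that is equidistant from two points, and such a mean could
  arise from two different tuples. As |c - s_j|^2 - |c - s_l|^2 is affine in c with gradient -2(s_j
  - s_l), a single tuple that maximizes the inner product with s_j - s_l for every i decides for all
  tuples at once whether a tie is left. Merging runs downwards in l because a merge changes only the
  measures of l and of some j < l, so the strictness reached for larger l is never lost.\<close>

lemma homogeneous_system_nontrivial:
  fixes a :: "'e \<Rightarrow> 'j \<Rightarrow> 'f::field"
  assumes "finite E" "finite J" "card E < card J"
  shows "\<exists>z. (\<exists>j\<in>J. z j \<noteq> 0) \<and> (\<forall>e\<in>E. (\<Sum>j\<in>J. a e j * z j) = 0)"
  using assms
proof (induction E arbitrary: J a rule: finite_induct)
  case empty
  then obtain j where "j \<in> J" by fastforce
  then show ?case by (intro exI[of _ "\<lambda>_. 1"]) auto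
next
  case (insert e E)
  show ?case
  proof (cases "\<forall>j\<in>J. a e j = 0")
    case True
    obtain z where "\<exists>j\<in>J. z j \<noteq> 0" "\<forall>f\<in>E. (\<Sum>j\<in>J. a f j * z j) = 0"
      using insert.IH[of J a] insert.hyps insert.prems by auto
    moreover have "(\<Sum>j\<in>J. a e j * z j) = 0"
      using True by simp
    ultimately show ?thesis by blast
  next
    case False
    then obtain j0 where j0: "j0 \<in> J" "a e j0 \<noteq> 0" by blast
    define J' where "J' = J - {j0}"
    \<comment> \<open>Gaussian elimination: equation \<open>e\<close> removes the unknown
      \<open>j0\<close> from all other equations, so the numbers of equations and of unknowns both
      drop by one. The value \<open>z0\<close> below is then forced by \<open>e\<close>.\<close>
    define a' where "a' f j = a f j - a f j0 * a e j / a e j0" for f j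
    have "finite J'" "card E < card J'"
      using insert.hyps insert.prems j0 by (auto simp: J'_def)
    then obtain z where z: "\<exists>j\<in>J'. z j \<noteq> 0" "\<forall>f\<in>E. (\<Sum>j\<in>J'. a' f j * z j) = 0"
      using insert.IH[of J' a'] by blast
    define z0 where "z0 = - (\<Sum>j\<in>J'. a e j * z j) / a e j0"
    define z' where "z' = z(j0 := z0)"
    have split: "(\<Sum>j\<in>J. a f j * z' j) = a f j0 * z0 + (\<Sum>j\<in>J'. a f j * z j)" for f
    proof -
      have "(\<Sum>j\<in>J. a f j * z' j) = a f j0 * z' j0 + (\<Sum>j\<in>J'. a f j * z' j)"
        unfolding J'_def using j0 insert.prems by (simp add: sum.remove)
      also have "(\<Sum>j\<in>J'. a f j * z' j) = (\<Sum>j\<in>J'. a f j * z j)"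
        by (rule sum.cong) (auto simp: z'_def J'_def)
      finally show ?thesis by (simp add: z'_def)
    qed
    have "(\<Sum>j\<in>J. a f j * z' j) = 0" if "f \<in> E" for f
    proof -
      have "a' f j * z j = a f j * z j - a f j0 / a e j0 * (a e j * z j)" for j
        by (simp add: a'_def left_diff_distrib)
      then have "(\<Sum>j\<in>J'. a' f j * z j) =
          (\<Sum>j\<in>J'. a f j * z j) - (\<Sum>j\<in>J'. a f j0 / a e j0 * (a e j * z j))"
        unfolding sum_subtractf[symmetric] by (intro sum.cong) auto
      then have "0 = (\<Sum>j\<in>J'. a f j * z j) - (\<Sum>j\<in>J'. a f j0 / a e j0 * (a e j * z j))"
        using z(2) that by simp
      also have "\<dots> = a f j0 * z0 + (\<Sum>j\<in>J'. a f j * z j)"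
        unfolding sum_distrib_left[symmetric] by (simp add: z0_def)
      finally show ?thesis by (simp add: split)
    qed
    moreover have "(\<Sum>j\<in>J. a e j * z' j) = 0"
      using j0 by (simp add: split z0_def)
    moreover have "\<exists>j\<in>J. z' j \<noteq> 0"
      using z(1) by (auto simp: z'_def J'_def)
    ultimately show ?thesis by blast
  qed
qed

lemma poly_mapping_of_fun:
  assumes "finite A" "\<And>x. x \<notin> A \<Longrightarrow> f x = 0"
  shows "\<exists>q. Poly_Mapping.lookup q = f"
proof
  have "finite {x. f x \<noteq> 0}"
    by (rule finite_subset[OF _ assms(1)]) (use assms(2) in auto)
  then show "Poly_Mapping.lookup (Abs_poly_mapping f) = f" by simp
qed

lemma lookup_scaleR_poly_mapping [simp]:
  "Poly_Mapping.lookup (c *\<^sub>R q) x = c *\<^sub>R Poly_Mapping.lookup q x"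
proof -
  have "finite {x. c *\<^sub>R Poly_Mapping.lookup q x \<noteq> 0}"
    by (rule finite_subset[OF _ finite_keys[of q]]) (auto simp: in_keys_iff)
  then show ?thesis by (simp add: scaleR_poly_mapping_def)
qed

text \<open>With the inclusions of keys turned into vanishing entries, a candidate given by its
  lookup functions can be checked entry by entry.\<close>

lemma lp_feasible_iff:
  "(z, y) \<in> lp_feasible S0 P \<longleftrightarrow>
     (\<forall>x. x \<notin> S0 \<longrightarrow> Poly_Mapping.lookup z x = 0) \<and>
     (\<forall>i x w. x \<notin> S0 \<or> w \<notin> set_pmf (P i) \<longrightarrow> Poly_Mapping.lookup y (i, x, w) = 0) \<and>
     (\<forall>i. \<forall>x\<in>S0. (\<Sum>w\<in>set_pmf (P i). Poly_Mapping.lookup y (i, x, w)) = Poly_Mapping.lookup z x) \<and>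
     (\<forall>i. \<forall>w\<in>set_pmf (P i). (\<Sum>x\<in>S0. Poly_Mapping.lookup y (i, x, w)) = pmf (P i) w) \<and>
     (\<forall>i. \<forall>x\<in>S0. \<forall>w\<in>set_pmf (P i). 0 \<le> Poly_Mapping.lookup y (i, x, w))"
proof -
  have "Poly_Mapping.keys z \<subseteq> S0 \<longleftrightarrow> (\<forall>x. x \<notin> S0 \<longrightarrow> Poly_Mapping.lookup z x = 0)"
    by (auto simp: in_keys_iff)
  moreover have "Poly_Mapping.keys y \<subseteq> {(i, x, w). x \<in> S0 \<and> w \<in> set_pmf (P i)} \<longleftrightarrow>
     (\<forall>i x w. x \<notin> S0 \<or> w \<notin> set_pmf (P i) \<longrightarrow> Poly_Mapping.lookup y (i, x, w) = 0)"
    by (auto simp: in_keys_iff subset_eq Ball_def split_paired_All)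
  ultimately show ?thesis unfolding lp_feasible_def by simp
qed

text \<open>
  Given more support points than claimed, some reweighting \<open>1 + h x\<close> of the rows of \<open>y\<close> keeps all
  column sums: for each \<open>i\<close> one column equation is implied by the others and \<open>\<Sum>x. z x * h x = 0\<close>.
\<close>

lemma lp_vertex_card_support:
  fixes P :: "'n::finite \<Rightarrow> 'a pmf"
  assumes S0: "finite S0" and P: "\<And>i. finite (set_pmf (P i))"
    and ext: "(z, y) extreme_point_of lp_feasible S0 P"
  shows "int (card (Poly_Mapping.keys z)) \<le> (\<Sum>i\<in>UNIV. int (card (set_pmf (P i)))) - int CARD('n) + 1"
proof (rule ccontr)
  assume large: "\<not> ?thesis"
  let ?z = "Poly_Mapping.lookup z" and ?y = "Poly_Mapping.lookup y"
  define J where "J = Poly_Mapping.keys z"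
  have feas: "(z, y) \<in> lp_feasible S0 P"
    using ext by (simp add: extreme_point_of_def)
  note F = feas[unfolded lp_feasible_iff]
  have JS: "J \<subseteq> S0" using F by (auto simp: J_def in_keys_iff)
  have z_nonneg: "0 \<le> ?z x" for x
  proof (cases "x \<in> S0")
    case True
    \<comment> \<open>\<open>z x\<close> is the row sum for every index, so any element of the index
      type will do; \<open>undefined\<close> is one.\<close>
    have "0 \<le> (\<Sum>w\<in>set_pmf (P undefined). ?y (undefined, x, w))"
      using F True by (intro sum_nonneg) auto
    then show ?thesis using F True by auto
  qed (use F in auto)
  have y_nonneg: "0 \<le> ?y (i, x, w)" for i x w
    using F by (cases "x \<in> S0 \<and> w \<in> set_pmf (P i)") auto
  have "\<forall>i. \<exists>w. w \<in> set_pmf (P i)" using set_pmf_not_empty by fast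
  then obtain k0 where k0: "\<And>i. k0 i \<in> set_pmf (P i)" by metis
  \<comment> \<open>One equation for the total, and |P_i| - 1 columns for each i with the column of
    \<open>k0 i\<close> left out. This is exactly the claimed bound, so more support points mean
    more unknowns than equations.\<close>
  define E where "E = insert None (Some ` (SIGMA i:UNIV. set_pmf (P i) - {k0 i}))"
  define a where "a e x = (case e of None \<Rightarrow> ?z x | Some (i, w) \<Rightarrow> ?y (i, x, w))" for e x
  have finE: "finite E" using P by (auto simp: E_def)
  have "card E = 1 + (\<Sum>i\<in>UNIV. card (set_pmf (P i) - {k0 i}))"
    unfolding E_def using P by (subst card_insert_disjoint) (auto simp: card_image)
  moreover have "int (card (set_pmf (P i) - {k0 i})) = int (card (set_pmf (P i))) - 1" for i
    using k0[of i] P[of i] card_gt_0_iff[of "set_pmf (P i)"]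
    by (subst card_Diff_singleton) (auto simp: of_nat_diff)
  ultimately have "int (card E) = 1 + (\<Sum>i\<in>(UNIV::'n set). int (card (set_pmf (P i))) - 1)"
    by simp
  then have "card E < card J"
    using large by (simp add: sum_subtractf J_def)
  then obtain h where h: "\<exists>x\<in>J. h x \<noteq> 0" "\<forall>e\<in>E. (\<Sum>x\<in>J. a e x * h x) = 0"
    using homogeneous_system_nontrivial[OF finE, of J a] by (auto simp: J_def)
  have hz: "(\<Sum>x\<in>J. ?z x * h x) = 0"
    using h(2) by (auto simp: E_def a_def)
  have hw': "(\<Sum>x\<in>J. ?y (i, x, w) * h x) = 0" if "w \<in> set_pmf (P i)" "w \<noteq> k0 i" for i w
  proof -
    have "Some (i, w) \<in> E" using that by (auto simp: E_def)
    then have "(\<Sum>x\<in>J. a (Some (i, w)) x * h x) = 0" using h(2) by blast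
    then show ?thesis by (simp add: a_def)
  qed
  have hw: "(\<Sum>x\<in>J. ?y (i, x, w) * h x) = 0" if "w \<in> set_pmf (P i)" for i w
  proof (cases "w = k0 i")
    case True
    have "0 = (\<Sum>x\<in>J. (\<Sum>w\<in>set_pmf (P i). ?y (i, x, w)) * h x)"
      unfolding hz[symmetric] using F JS by (intro sum.cong) auto
    also have "\<dots> = (\<Sum>w\<in>set_pmf (P i). \<Sum>x\<in>J. ?y (i, x, w) * h x)"
      by (subst sum.swap) (simp add: sum_distrib_right)
    also have "\<dots> = (\<Sum>w\<in>{k0 i}. \<Sum>x\<in>J. ?y (i, x, w) * h x)"
      using P k0 hw' by (intro sum.mono_neutral_right) auto
    finally show ?thesis using True by simp
  qed (use that hw' in blast)
  \<comment> \<open>Scaling by this constant brings all perturbations into [-1, 1], so the factors 1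
    + u and 1 - u are both nonnegative. The summand 1 keeps the denominator positive.\<close>
  define eps where "eps = 1 / (1 + (\<Sum>x\<in>J. \<bar>h x\<bar>))"
  have "0 \<le> (\<Sum>x\<in>J. \<bar>h x\<bar>)" by (simp add: sum_nonneg)
  then have eps: "0 < eps" by (simp add: eps_def add_pos_nonneg)
  define u where "u x = (if x \<in> J then eps * h x else 0)" for x
  have u_le: "\<bar>u x\<bar> \<le> 1" for x
  proof (cases "x \<in> J")
    case True
    then have "\<bar>h x\<bar> \<le> (\<Sum>x\<in>J. \<bar>h x\<bar>)"
      by (intro member_le_sum) (auto simp: J_def)
    then show ?thesis
      using True eps by (simp add: u_def abs_mult eps_def divide_simps)
  qed (simp add: u_def)
  have yu: "(\<Sum>x\<in>S0. ?y (i, x, w) * u x) = 0" if "w \<in> set_pmf (P i)" for i w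
  proof -
    have "(\<Sum>x\<in>S0. ?y (i, x, w) * u x) = (\<Sum>x\<in>J. ?y (i, x, w) * u x)"
      using JS S0 by (intro sum.mono_neutral_right) (auto simp: u_def)
    also have "\<dots> = eps * (\<Sum>x\<in>J. ?y (i, x, w) * h x)"
      by (simp add: u_def sum_distrib_left algebra_simps)
    finally show ?thesis using hw[OF that] by simp
  qed
  \<comment> \<open>Both signs are needed: the vertex would be the midpoint of the two perturbed
    solutions, and these differ because \<open>h\<close> is nonzero at some support point.\<close>
  have perturbed: "\<exists>z' y'. (z', y') \<in> lp_feasible S0 P \<and>
      Poly_Mapping.lookup z' = (\<lambda>x. ?z x * (1 + \<sigma> * u x)) \<and>
      Poly_Mapping.lookup y' = (\<lambda>(i, x, w). ?y (i, x, w) * (1 + \<sigma> * u x))" if \<sigma>: "\<bar>\<sigma>\<bar> = 1" for \<sigma>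
  proof -
    have "finite (Poly_Mapping.keys z)" "finite (Poly_Mapping.keys y)" by auto
    then obtain z' y' where z': "Poly_Mapping.lookup z' = (\<lambda>x. ?z x * (1 + \<sigma> * u x))"
      and y': "Poly_Mapping.lookup y' = (\<lambda>(i, x, w). ?y (i, x, w) * (1 + \<sigma> * u x))"
      using poly_mapping_of_fun[of "Poly_Mapping.keys z" "\<lambda>x. ?z x * (1 + \<sigma> * u x)"]
        poly_mapping_of_fun[of "Poly_Mapping.keys y" "\<lambda>(i, x, w). ?y (i, x, w) * (1 + \<sigma> * u x)"]
      by (fastforce simp: in_keys_iff)
    have "\<bar>\<sigma> * u x\<bar> \<le> 1" for x
      using u_le[of x] by (simp add: abs_mult \<sigma>)
    then have factor: "0 \<le> 1 + \<sigma> * u x" for x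
      by (smt (verit))
    have "(z', y') \<in> lp_feasible S0 P"
      unfolding lp_feasible_iff z' y'
    proof (intro conjI allI ballI impI; (simp only: prod.case)?)
      fix x assume "x \<notin> S0"
      then show "?z x * (1 + \<sigma> * u x) = 0" using F by simp
    next
      fix i x w assume "x \<notin> S0 \<or> w \<notin> set_pmf (P i)"
      then show "?y (i, x, w) * (1 + \<sigma> * u x) = 0" using F by simp
    next
      fix i x assume "x \<in> S0"
      then show "(\<Sum>w\<in>set_pmf (P i). ?y (i, x, w) * (1 + \<sigma> * u x)) = ?z x * (1 + \<sigma> * u x)"
        using F by (simp add: sum_distrib_right[symmetric])
    next
      fix i w assume w: "w \<in> set_pmf (P i)"
      have "(\<Sum>x\<in>S0. ?y (i, x, w) * (1 + \<sigma> * u x)) =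
          (\<Sum>x\<in>S0. ?y (i, x, w)) + \<sigma> * (\<Sum>x\<in>S0. ?y (i, x, w) * u x)"
        by (simp add: algebra_simps sum.distrib sum_distrib_left)
      then show "(\<Sum>x\<in>S0. ?y (i, x, w) * (1 + \<sigma> * u x)) = pmf (P i) w"
        using F w yu[OF w] by simp
    next
      fix i x w
      show "0 \<le> ?y (i, x, w) * (1 + \<sigma> * u x)"
        using y_nonneg factor by simp
    qed
    with z' y' show ?thesis by blast
  qed
  obtain z1 y1 where 1: "(z1, y1) \<in> lp_feasible S0 P"
      "Poly_Mapping.lookup z1 = (\<lambda>x. ?z x * (1 + u x))"
      "Poly_Mapping.lookup y1 = (\<lambda>(i, x, w). ?y (i, x, w) * (1 + u x))"
    using perturbed[of 1] by auto
  obtain z2 y2 where 2: "(z2, y2) \<in> lp_feasible S0 P"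
      "Poly_Mapping.lookup z2 = (\<lambda>x. ?z x * (1 - u x))"
      "Poly_Mapping.lookup y2 = (\<lambda>(i, x, w). ?y (i, x, w) * (1 - u x))"
    using perturbed[of "-1"] by auto
  obtain x where x: "x \<in> J" "h x \<noteq> 0" using h(1) by blast
  then have "?z x * (1 + u x) \<noteq> ?z x * (1 - u x)"
    using eps by (auto simp: J_def u_def in_keys_iff)
  then have "z1 \<noteq> z2" using 1(2) 2(2) by metis
  then have "midpoint (z1, y1) (z2, y2) \<in> open_segment (z1, y1) (z2, y2)"
    by simp
  moreover have "midpoint (z1, y1) (z2, y2) = (z, y)"
  proof -
    have "(1/2) *\<^sub>R (z1 + z2) = z"
      by (rule poly_mapping_eqI) (simp add: lookup_add 1 2 algebra_simps)
    moreover have "(1/2) *\<^sub>R (y1 + y2) = y"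
      by (rule poly_mapping_eqI) (auto simp: lookup_add 1 2 field_simps split: prod.splits)
    ultimately show ?thesis by (simp add: midpoint_def)
  qed
  ultimately show False
    using ext 1(1) 2(1) unfolding extreme_point_of_def by metis
qed

text \<open>Competitors of the vertex are constructed as ordinary functions. Cutting them off
  outside the index sets changes neither sums nor cost and makes them finitely supported, hence
  feasible.\<close>

lemma algorithm1_optimal:
  fixes P :: "'n::finite \<Rightarrow> 'a::euclidean_space pmf"
  assumes alg1: "algorithm1_output S0 P lam Porg y"
    and S0: "finite S0" and P: "\<And>i. finite (set_pmf (P i))"
    and row: "\<And>i x. x \<in> S0 \<Longrightarrow> (\<Sum>w\<in>set_pmf (P i). g i x w) = z x"
    and column: "\<And>i w. w \<in> set_pmf (P i) \<Longrightarrow> (\<Sum>x\<in>S0. g i x w) = pmf (P i) w"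
    and nonneg: "\<And>i x w. x \<in> S0 \<Longrightarrow> w \<in> set_pmf (P i) \<Longrightarrow> 0 \<le> g i x w"
  shows "lp_cost S0 P lam y \<le> transport_cost S0 P lam g"
proof -
  obtain z' where z': "Poly_Mapping.lookup z' = (\<lambda>x. if x \<in> S0 then z x else 0)"
    using poly_mapping_of_fun[OF S0, of "\<lambda>x. if x \<in> S0 then z x else 0"] by auto
  have fin: "finite ((UNIV :: 'n set) \<times> S0 \<times> S_org P)" using S0 P by (auto simp: S_org_def)
  have "\<exists>q. Poly_Mapping.lookup q =
      (\<lambda>(i, x, w). if x \<in> S0 \<and> w \<in> set_pmf (P i) then g i x w else 0)"
    by (rule poly_mapping_of_fun[OF fin]) (auto simp: S_org_def split: if_splits)
  then obtain y' where y': "Poly_Mapping.lookup y' =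
      (\<lambda>(i, x, w). if x \<in> S0 \<and> w \<in> set_pmf (P i) then g i x w else 0)" by blast
  have "(z', y') \<in> lp_feasible S0 P"
    unfolding lp_feasible_iff z' y' using row column nonneg by auto
  then have "lp_cost S0 P lam y \<le> lp_cost S0 P lam y'"
    using alg1 by (auto simp: algorithm1_output_def)
  also have "lp_cost S0 P lam y' = transport_cost S0 P lam g"
    by (simp add: lp_cost_def transport_cost_def y')
  finally show ?thesis .
qed


section \<open>Couplings with finitely supported measures\<close>

lemma pmf_of_mass_function:
  assumes "finite X" "\<And>x. 0 \<le> m x" "\<And>x. x \<notin> X \<Longrightarrow> m x = 0" "(\<Sum>x\<in>X. m x) = 1"
  shows "\<exists>p. pmf p = m"
proof -
  have "(\<integral>\<^sup>+x. ennreal (m x) \<partial>count_space UNIV) = (\<Sum>x\<in>X. ennreal (m x))"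
    using assms by (intro nn_integral_count_space') auto
  then have "(\<integral>\<^sup>+x. ennreal (m x) \<partial>count_space UNIV) = 1"
    using assms by (simp add: sum_ennreal)
  then have "pmf (embed_pmf m) = m"
    using assms(2) by (auto simp: pmf_embed_pmf)
  then show ?thesis by blast
qed

section \<open>Discrete measures on the Borel sets\<close>

lemma sets_borel_pmf [measurable_cong]: "sets (borel_pmf p) = sets borel"
  by (simp add: borel_pmf_def)

lemma prob_space_borel_pmf: "prob_space (borel_pmf p)"
  unfolding borel_pmf_def by (rule measure_pmf.prob_space_distr) auto

lemma nn_integral_borel_pmf:
  assumes "finite (set_pmf p)" "f \<in> borel_measurable borel"
  shows "(\<integral>\<^sup>+w. f w \<partial>borel_pmf p) = (\<Sum>w\<in>set_pmf p. f w * ennreal (pmf p w))"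
  unfolding borel_pmf_def using assms
  by (subst nn_integral_distr) (auto simp: nn_integral_measure_pmf_finite)

lemma AE_borel_pmf:
  assumes "finite (set_pmf p)"
  shows "AE w in borel_pmf p. w \<in> set_pmf p"
  unfolding borel_pmf_def using assms
  by (subst AE_distr_iff) (auto simp: AE_measure_pmf intro: finite_imp_closed borel_closed)

text \<open>The plan \<open>g\<close>, read as a probability mass function on pairs, is one of the
  couplings over which the infimum in \<open>W2\<close> is taken.\<close>

lemma W2_le_transport_cost:
  fixes p q :: "'a::euclidean_space pmf"
  assumes fin: "finite (set_pmf q)" "finite (set_pmf p)"
    and nonneg: "\<And>x w. x \<in> set_pmf q \<Longrightarrow> w \<in> set_pmf p \<Longrightarrow> 0 \<le> g x w"
    and row: "\<And>x. x \<in> set_pmf q \<Longrightarrow> (\<Sum>w\<in>set_pmf p. g x w) = pmf q x"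
    and column: "\<And>w. w \<in> set_pmf p \<Longrightarrow> (\<Sum>x\<in>set_pmf q. g x w) = pmf p w"
  shows "(W2 (borel_pmf q) (borel_pmf p))\<^sup>2 \<le> (\<Sum>x\<in>set_pmf q. \<Sum>w\<in>set_pmf p. (norm (x - w))\<^sup>2 * g x w)"
proof -
  define X where "X = set_pmf q \<times> set_pmf p"
  define G where "G z = (if z \<in> X then g (fst z) (snd z) else 0)" for z
  have finX: "finite X" using fin by (simp add: X_def)
  have G_nonneg: "0 \<le> G z" for z using nonneg by (auto simp: G_def X_def)
  have sumX: "(\<Sum>z\<in>X. F z * G z) = (\<Sum>x\<in>set_pmf q. \<Sum>w\<in>set_pmf p. F (x, w) * g x w)" for F :: "_ \<Rightarrow> real"
    unfolding X_def by (subst sum.cartesian_product') (auto simp: G_def X_def intro!: sum.cong)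
  have "(\<Sum>z\<in>X. G z) = 1"
    using sumX[of "\<lambda>_. 1"] row sum_pmf_eq_1[OF fin(1) order_refl] by simp
  moreover have "G z = 0" if "z \<notin> X" for z using that by (simp add: G_def)
  ultimately obtain k where "pmf k = G"
    using pmf_of_mass_function[where m = G, OF finX] G_nonneg by blast
  then have pmf_k: "pmf k z = G z" for z by simp
  have set_k: "set_pmf k \<subseteq> X" by (auto simp: set_pmf_eq pmf_k G_def)
  have pmf_map: "pmf (map_pmf f k) x = (\<Sum>z\<in>{z\<in>X. f z = x}. G z)" for f :: "_ \<Rightarrow> 'a" and x
  proof -
    have "pmf (map_pmf f k) x = measure (measure_pmf k) (f -` {x} \<inter> set_pmf k)"
      by (simp add: pmf_map measure_Int_set_pmf)
    also have "f -` {x} \<inter> set_pmf k = {z\<in>X. f z = x} \<inter> set_pmf k"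
      using set_k by auto
    also have "measure (measure_pmf k) \<dots> = (\<Sum>z\<in>{z\<in>X. f z = x}. G z)"
      using finX by (simp add: measure_Int_set_pmf measure_measure_pmf_finite pmf_k)
    finally show ?thesis .
  qed
  have "map_pmf fst k = q"
  proof (rule pmf_eqI)
    fix x
    have "{z\<in>X. fst z = x} = (if x \<in> set_pmf q then Pair x ` set_pmf p else {})"
      by (auto simp: X_def)
    moreover have "(\<Sum>z\<in>Pair x ` set_pmf p. G z) = pmf q x" if "x \<in> set_pmf q"
      using that row[OF that] by (simp add: sum.reindex inj_on_def G_def X_def)
    ultimately show "pmf (map_pmf fst k) x = pmf q x"
      by (simp add: pmf_map set_pmf_iff)
  qed
  moreover have "map_pmf snd k = p"
  proof (rule pmf_eqI)
    fix w
    have "{z\<in>X. snd z = w} = (if w \<in> set_pmf p then (\<lambda>x. (x, w)) ` set_pmf q else {})"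
      by (auto simp: X_def)
    moreover have "(\<Sum>z\<in>(\<lambda>x. (x, w)) ` set_pmf q. G z) = pmf p w" if "w \<in> set_pmf p"
      using that column[OF that] by (simp add: sum.reindex inj_on_def G_def X_def)
    ultimately show "pmf (map_pmf snd k) w = pmf p w"
      by (simp add: pmf_map set_pmf_iff)
  qed
  \<comment> \<open>The measure of \<open>k\<close> lives on the power set of the pairs; the
    identity map carries it to the product of the Borel sets, where couplings are defined.\<close>
  moreover define \<pi> where "\<pi> = distr (measure_pmf k) (borel \<Otimes>\<^sub>M borel) (\<lambda>z. z)"
  moreover have "distr \<pi> borel f = borel_pmf (map_pmf f k)"
    if "f \<in> borel \<Otimes>\<^sub>M borel \<rightarrow>\<^sub>M borel" for f :: "'a \<times> 'a \<Rightarrow> 'a"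
    unfolding \<pi>_def borel_pmf_def map_pmf_rep_eq
    using that by (subst (1 2) distr_distr) (simp_all add: comp_def space_pair_measure)
  ultimately have "distr \<pi> borel fst = borel_pmf q" "distr \<pi> borel snd = borel_pmf p"
    by simp_all
  then have "\<pi> \<in> couplings (borel_pmf q) (borel_pmf p)"
    by (simp add: couplings_def) (simp add: \<pi>_def)
  then have "(INF \<pi>\<in>couplings (borel_pmf q) (borel_pmf p). \<integral>\<^sup>+z. ennreal ((norm (fst z - snd z))\<^sup>2) \<partial>\<pi>)
      \<le> (\<integral>\<^sup>+z. ennreal ((norm (fst z - snd z))\<^sup>2) \<partial>\<pi>)"
    by (rule INF_lower)
  also have "\<dots> = (\<integral>\<^sup>+z. ennreal ((norm (fst z - snd z))\<^sup>2) \<partial>measure_pmf k)"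
    unfolding \<pi>_def by (rule nn_integral_distr) (simp_all add: space_pair_measure)
  also have "\<dots> = (\<Sum>z\<in>X. ennreal ((norm (fst z - snd z))\<^sup>2) * ennreal (pmf k z))"
    using finX set_k by (intro nn_integral_measure_pmf_support) (auto simp: set_pmf_iff)
  also have "\<dots> = ennreal (\<Sum>z\<in>X. (norm (fst z - snd z))\<^sup>2 * G z)"
    using G_nonneg by (simp add: pmf_k ennreal_mult[symmetric] sum_ennreal)
  finally have "enn2real (INF \<pi>\<in>couplings (borel_pmf q) (borel_pmf p). \<integral>\<^sup>+z. ennreal ((norm (fst z - snd z))\<^sup>2) \<partial>\<pi>)
      \<le> (\<Sum>z\<in>X. (norm (fst z - snd z))\<^sup>2 * G z)"
    using G_nonneg by (intro enn2real_leI) (auto intro!: sum_nonneg)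
  then show ?thesis
    by (simp add: W2_def sumX)
qed

lemma phi_le_transport_cost:
  fixes P :: "'n::finite \<Rightarrow> 'a::euclidean_space pmf"
  assumes "finite (set_pmf q)" "\<And>i. finite (set_pmf (P i))" "\<And>i. 0 \<le> lam i" "transport q P y"
  shows "phi P lam (borel_pmf q) \<le> transport_cost (set_pmf q) P lam y"
  unfolding phi_def transport_cost_def
  using assms by (intro sum_mono mult_left_mono W2_le_transport_cost) (auto simp: transport_def)

text \<open>
  The functions \<open>f w\<close> are densities with respect to \<open>M\<close> of the parts of the coupling lying over
  the points \<open>w\<close> of the finite support.
\<close>

lemma coupling_disintegration:
  fixes p :: "'a::euclidean_space pmf"
  assumes M: "prob_space M" "sets M = sets borel" and p: "finite (set_pmf p)"
    and \<pi>: "\<pi> \<in> couplings M (borel_pmf p)"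
  obtains f :: "'a \<Rightarrow> 'a \<Rightarrow> real"
  where "\<And>w. f w \<in> borel_measurable borel" "\<And>w x. 0 \<le> f w x"
    "AE x in M. (\<Sum>w\<in>set_pmf p. f w x) = 1"
    "\<And>w. w \<in> set_pmf p \<Longrightarrow> (\<integral>\<^sup>+x. ennreal (f w x) \<partial>M) = ennreal (pmf p w)"
    "(\<integral>\<^sup>+z. ennreal ((norm (fst z - snd z))\<^sup>2) \<partial>\<pi>)
       = (\<integral>\<^sup>+x. ennreal (\<Sum>w\<in>set_pmf p. (norm (x - w))\<^sup>2 * f w x) \<partial>M)"
proof -
  interpret M: prob_space M by fact
  note [measurable_cong] = M(2)
  have sets_pi [measurable_cong]: "sets \<pi> = sets (borel \<Otimes>\<^sub>M borel)"
    and fst_pi: "distr \<pi> borel fst = M" and snd_pi: "distr \<pi> borel snd = borel_pmf p"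
    using \<pi> by (auto simp: couplings_def)
  have AE_snd: "AE z in \<pi>. snd z \<in> set_pmf p"
    using AE_borel_pmf[OF p] unfolding snd_pi[symmetric]
    by (rule AE_distrD[rotated]) simp
  \<comment> \<open>The part of \<open>\<pi>\<close> on the fibre over \<open>w\<close>; its first
    marginal \<open>\<nu> w\<close> lies below \<open>M\<close>, hence is finite and absolutely
    continuous, and Radon-Nikodym yields the density \<open>f w\<close>.\<close>
  define \<pi>' where "\<pi>' w = density \<pi> (indicator {z. snd z = w})" for w
  have [measurable_cong]: "sets (\<pi>' w) = sets (borel \<Otimes>\<^sub>M borel)" for w
    by (simp add: \<pi>'_def sets_pi)
  define \<nu> where "\<nu> w = distr (\<pi>' w) borel fst" for w
  have [measurable]: "{z::'a \<times> 'a. snd z = w} \<in> sets (borel \<Otimes>\<^sub>M borel)" for w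
  proof -
    have "{z::'a \<times> 'a. snd z = w} = UNIV \<times> {w}" by auto
    then show ?thesis by simp
  qed
  have nn_\<nu>: "(\<integral>\<^sup>+x. h x \<partial>\<nu> w) = (\<integral>\<^sup>+z. indicator {z. snd z = w} z * h (fst z) \<partial>\<pi>)"
    if [measurable]: "h \<in> borel_measurable borel" for h w
    unfolding \<nu>_def \<pi>'_def
    by (subst nn_integral_distr, simp, simp, subst nn_integral_density) simp_all
  have em_\<nu>: "emeasure (\<nu> w) A = (\<integral>\<^sup>+z. indicator {z. snd z = w} z * indicator A (fst z) \<partial>\<pi>)"
    if "A \<in> sets borel" for w A
    using nn_\<nu>[of "indicator A" w] that by (simp add: \<nu>_def)
  have em_M: "emeasure M A = (\<integral>\<^sup>+z. indicator A (fst z) \<partial>\<pi>)" if [measurable]: "A \<in> sets borel" for A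
    unfolding fst_pi[symmetric]
    by (subst nn_integral_indicator[symmetric], simp, subst nn_integral_distr) simp_all
  have \<nu>_le: "emeasure (\<nu> w) A \<le> emeasure M A" if "A \<in> sets borel" for w A
    unfolding em_\<nu>[OF that] em_M[OF that]
    by (intro nn_integral_mono) (auto simp: indicator_def)
  have sets_\<nu> [measurable_cong]: "sets (\<nu> w) = sets borel" for w by (simp add: \<nu>_def)
  have fin_\<nu>: "finite_measure (\<nu> w)" for w
  proof
    have "emeasure (\<nu> w) UNIV \<le> emeasure M UNIV" by (rule \<nu>_le) simp
    also have "\<dots> \<le> 1" by (rule M.emeasure_le_1)
    also have "1 < (\<infinity> :: ennreal)" by simp
    finally show "emeasure (\<nu> w) (space (\<nu> w)) \<noteq> \<infinity>"
      by (simp add: \<nu>_def)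
  qed
  have ac: "absolutely_continuous M (\<nu> w)" for w
    unfolding absolutely_continuous_def
  proof
    fix A assume "A \<in> null_sets M"
    then have "A \<in> sets borel" "emeasure M A = 0" by (auto simp: null_sets_def M(2))
    then show "A \<in> null_sets (\<nu> w)"
      using \<nu>_le[of A w] by (auto simp: null_sets_def sets_\<nu>)
  qed
  have "\<exists>D. D \<in> borel_measurable borel \<and> (\<forall>x. 0 \<le> D x) \<and> density M (\<lambda>x. ennreal (D x)) = \<nu> w" for w
  proof -
    obtain D where D: "D \<in> borel_measurable M" "AE x in M. RN_deriv M (\<nu> w) x = ennreal (D x)"
        "\<And>x. 0 \<le> D x"
      using M.real_RN_deriv[OF fin_\<nu> ac] sets_\<nu> M(2) by metis
    have "density M (\<lambda>x. ennreal (D x)) = density M (RN_deriv M (\<nu> w))"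
    proof (rule density_cong)
      show "AE x in M. ennreal (D x) = RN_deriv M (\<nu> w) x"
        using D(2) by eventually_elim simp
    qed (use D(1) in measurable)
    also have "\<dots> = \<nu> w"
      using ac by (intro M.density_RN_deriv) (auto simp: sets_\<nu> M(2))
    finally show ?thesis using D(1,3) measurable_cong_sets[OF M(2) refl] by blast
  qed
  then obtain f where f [measurable]: "\<And>w. f w \<in> borel_measurable borel"
      and f_nonneg: "\<And>w x. 0 \<le> f w x"
      and f_density: "\<And>w. density M (\<lambda>x. ennreal (f w x)) = \<nu> w"
    by metis
  have total: "(\<Sum>w\<in>set_pmf p. indicator {z. snd z = w} z * c) = c" if "snd z \<in> set_pmf p"
    for z :: "'a \<times> 'a" and c :: ennreal
  proof -
    have "(\<Sum>w\<in>set_pmf p. indicator {z. snd z = w} z * c) = (\<Sum>w\<in>set_pmf p. if snd z = w then c else 0)"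
      by (intro sum.cong) (auto simp: indicator_def)
    then show ?thesis using that p by simp
  qed
  have nn_f: "(\<integral>\<^sup>+x. h x \<partial>\<nu> w) = (\<integral>\<^sup>+x. ennreal (f w x) * h x \<partial>M)"
    if [measurable]: "h \<in> borel_measurable borel" for h w
    unfolding f_density[symmetric] by (rule nn_integral_density) measurable
  \<comment> \<open>Almost all of \<open>\<pi>\<close> lies over the finitely many support points,
    so the measures \<open>\<nu> w\<close> add up to \<open>M\<close>. Uniqueness of densities turns
    this into a statement about almost every \<open>x\<close>.\<close>
  have "density M (\<lambda>x. ennreal (\<Sum>w\<in>set_pmf p. f w x)) = density M (\<lambda>_. 1)"
  proof (rule measure_eqI)
    fix A assume "A \<in> sets (density M (\<lambda>x. ennreal (\<Sum>w\<in>set_pmf p. f w x)))"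
    then have A [measurable]: "A \<in> sets borel" by (simp add: M(2))
    have "emeasure (density M (\<lambda>x. ennreal (\<Sum>w\<in>set_pmf p. f w x))) A
        = (\<integral>\<^sup>+x. (\<Sum>w\<in>set_pmf p. ennreal (f w x) * indicator A x) \<partial>M)"
      by (subst emeasure_density) (auto simp: sum_ennreal[symmetric] f_nonneg sum_distrib_right
          simp del: sum_ennreal intro!: nn_integral_cong)
    also have "\<dots> = (\<Sum>w\<in>set_pmf p. emeasure (\<nu> w) A)"
      by (subst nn_integral_sum) (auto simp: nn_f[symmetric] sets_\<nu>)
    also have "\<dots> = (\<integral>\<^sup>+z. (\<Sum>w\<in>set_pmf p. indicator {z. snd z = w} z * indicator A (fst z)) \<partial>\<pi>)"
      by (subst nn_integral_sum) (simp_all add: em_\<nu>)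
    also have "\<dots> = emeasure M A"
      unfolding em_M[OF A] using AE_snd by (intro nn_integral_cong_AE) (auto simp: total)
    finally show "emeasure (density M (\<lambda>x. ennreal (\<Sum>w\<in>set_pmf p. f w x))) A = emeasure (density M (\<lambda>_. 1)) A"
      by (simp add: emeasure_density M(2))
  qed simp
  then have "AE x in M. ennreal (\<Sum>w\<in>set_pmf p. f w x) = 1"
    by (intro M.density_unique) auto
  then have f_sum: "AE x in M. (\<Sum>w\<in>set_pmf p. f w x) = 1"
    by eventually_elim (metis ennreal_1 ennreal_inj f_nonneg sum_nonneg zero_le_one)
  have f_mass: "(\<integral>\<^sup>+x. ennreal (f w x) \<partial>M) = ennreal (pmf p w)" if w: "w \<in> set_pmf p" for w
  proof -
    have "(\<integral>\<^sup>+x. ennreal (f w x) \<partial>M) = (\<integral>\<^sup>+z. indicator {w} (snd z) \<partial>\<pi>)"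
      using nn_f[of "\<lambda>_. 1" w] nn_\<nu>[of "\<lambda>_. 1" w] by (simp add: indicator_def)
    also have "\<dots> = (\<integral>\<^sup>+v. indicator {w} v \<partial>borel_pmf p)"
      unfolding snd_pi[symmetric] by (rule nn_integral_distr[symmetric]) simp_all
    also have "\<dots> = (\<Sum>v\<in>set_pmf p. indicator {w} v * ennreal (pmf p v))"
      using p by (rule nn_integral_borel_pmf) simp
    also have "\<dots> = (\<Sum>v\<in>set_pmf p. if v = w then ennreal (pmf p w) else 0)"
      by (rule sum.cong) (simp_all add: indicator_def)
    finally show ?thesis using w p by simp
  qed
  have f_cost: "(\<integral>\<^sup>+z. ennreal ((norm (fst z - snd z))\<^sup>2) \<partial>\<pi>)
       = (\<integral>\<^sup>+x. ennreal (\<Sum>w\<in>set_pmf p. (norm (x - w))\<^sup>2 * f w x) \<partial>M)"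
  proof -
    have "(\<integral>\<^sup>+z. ennreal ((norm (fst z - snd z))\<^sup>2) \<partial>\<pi>)
        = (\<integral>\<^sup>+z. (\<Sum>w\<in>set_pmf p. indicator {z. snd z = w} z * ennreal ((norm (fst z - w))\<^sup>2)) \<partial>\<pi>)"
    proof (rule nn_integral_cong_AE, use AE_snd in eventually_elim)
      fix z :: "'a \<times> 'a" assume z: "snd z \<in> set_pmf p"
      have "(\<Sum>w\<in>set_pmf p. indicator {z. snd z = w} z * ennreal ((norm (fst z - w))\<^sup>2))
          = (\<Sum>w\<in>set_pmf p. indicator {z. snd z = w} z * ennreal ((norm (fst z - snd z))\<^sup>2))"
        by (intro sum.cong) (auto simp: indicator_def)
      then show "ennreal ((norm (fst z - snd z))\<^sup>2)
          = (\<Sum>w\<in>set_pmf p. indicator {z. snd z = w} z * ennreal ((norm (fst z - w))\<^sup>2))"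
        by (simp add: total[OF z])
    qed
    also have "\<dots> = (\<Sum>w\<in>set_pmf p. \<integral>\<^sup>+x. ennreal ((norm (x - w))\<^sup>2) \<partial>\<nu> w)"
      by (subst nn_integral_sum) (simp_all add: nn_\<nu>)
    also have "\<dots> = (\<Sum>w\<in>set_pmf p. \<integral>\<^sup>+x. ennreal ((norm (x - w))\<^sup>2 * f w x) \<partial>M)"
      by (simp add: nn_f ennreal_mult f_nonneg mult.commute)
    also have "\<dots> = (\<integral>\<^sup>+x. (\<Sum>w\<in>set_pmf p. ennreal ((norm (x - w))\<^sup>2 * f w x)) \<partial>M)"
      by (rule nn_integral_sum[symmetric]) measurable
    finally show ?thesis by (simp add: f_nonneg)
  qed
  show thesis
    by (rule that[OF f f_nonneg f_sum f_mass f_cost])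
qed

text \<open>The product measure is a coupling. This keeps the infimum in \<open>W2\<close> from
  being taken over the empty set, where it would be infinite.\<close>

lemma couplings_nonempty:
  fixes p :: "'a::euclidean_space pmf"
  assumes M: "prob_space M" "sets M = sets borel"
  shows "couplings M (borel_pmf p) \<noteq> {}"
proof -
  interpret M: prob_space M by fact
  interpret p: prob_space "borel_pmf p" by (rule prob_space_borel_pmf)
  interpret pair_prob_space M "borel_pmf p" ..
  have "distr (M \<Otimes>\<^sub>M borel_pmf p) M fst = M"
    by (rule p.distr_pair_fst)
  then have "distr (M \<Otimes>\<^sub>M borel_pmf p) borel fst = M"
    by (metis M(2) distr_cong)
  moreover have "distr (M \<Otimes>\<^sub>M borel_pmf p) (borel_pmf p) snd = borel_pmf p"
  proof (rule measure_eqI)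
    fix A assume "A \<in> sets (distr (M \<Otimes>\<^sub>M borel_pmf p) (borel_pmf p) snd)"
    then have A: "A \<in> sets (borel_pmf p)" by simp
    then have "emeasure (distr (M \<Otimes>\<^sub>M borel_pmf p) (borel_pmf p) snd) A =
        emeasure (M \<Otimes>\<^sub>M borel_pmf p) (space M \<times> A)"
      by (auto simp: emeasure_distr space_pair_measure dest: sets.sets_into_space
          intro!: arg_cong2[where f = emeasure])
    with A show "emeasure (distr (M \<Otimes>\<^sub>M borel_pmf p) (borel_pmf p) snd) A = emeasure (borel_pmf p) A"
      by (simp add: p.emeasure_pair_measure_Times M.emeasure_space_1)
  qed simp
  then have "distr (M \<Otimes>\<^sub>M borel_pmf p) borel snd = borel_pmf p"
    by (metis sets_borel_pmf distr_cong)
  moreover have "sets (M \<Otimes>\<^sub>M borel_pmf p) = sets (borel \<Otimes>\<^sub>M borel)"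
    by (intro sets_pair_measure_cong M(2) sets_borel_pmf)
  ultimately have "M \<Otimes>\<^sub>M borel_pmf p \<in> couplings M (borel_pmf p)"
    by (simp add: couplings_def)
  then show ?thesis by blast
qed

text \<open>By the parallelogram law the integrand is at most twice the sum of the two squared
  norms, and these integrate to the second moments of the marginals.\<close>

lemma coupling_cost_finite:
  fixes p :: "'a::euclidean_space pmf"
  assumes M: "M \<in> finite_second_moment_measures" and p: "finite (set_pmf p)"
    and \<pi>: "\<pi> \<in> couplings M (borel_pmf p)"
  shows "(\<integral>\<^sup>+z. ennreal ((norm (fst z - snd z))\<^sup>2) \<partial>\<pi>) < \<infinity>"
proof -
  have [measurable_cong]: "sets \<pi> = sets (borel \<Otimes>\<^sub>M borel)"
    and fst_pi: "distr \<pi> borel fst = M" and snd_pi: "distr \<pi> borel snd = borel_pmf p"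
    using \<pi> by (auto simp: couplings_def)
  have bound: "(norm (a - b))\<^sup>2 \<le> 2 * (norm a)\<^sup>2 + 2 * (norm b)\<^sup>2" for a b :: 'a
  proof -
    have "(norm (a - b))\<^sup>2 + (norm (a + b))\<^sup>2 = 2 * (norm a)\<^sup>2 + 2 * (norm b)\<^sup>2"
      by (simp add: power2_norm_eq_inner algebra_simps inner_commute)
    then show ?thesis by (smt (verit) zero_le_power2)
  qed
  have "(\<integral>\<^sup>+z. ennreal ((norm (fst z - snd z))\<^sup>2) \<partial>\<pi>) \<le>
      (\<integral>\<^sup>+z. 2 * ennreal ((norm (fst z))\<^sup>2) + 2 * ennreal ((norm (snd z))\<^sup>2) \<partial>\<pi>)"
  proof (rule nn_integral_mono)
    fix z :: "'a \<times> 'a"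
    have "ennreal ((norm (fst z - snd z))\<^sup>2) \<le> ennreal (2 * (norm (fst z))\<^sup>2 + 2 * (norm (snd z))\<^sup>2)"
      by (intro ennreal_leI bound)
    then show "ennreal ((norm (fst z - snd z))\<^sup>2) \<le> 2 * ennreal ((norm (fst z))\<^sup>2) + 2 * ennreal ((norm (snd z))\<^sup>2)"
      by (simp add: ennreal_mult)
  qed
  also have "\<dots> = 2 * (\<integral>\<^sup>+z. ennreal ((norm (fst z))\<^sup>2) \<partial>\<pi>) + 2 * (\<integral>\<^sup>+z. ennreal ((norm (snd z))\<^sup>2) \<partial>\<pi>)"
    by (simp add: nn_integral_add nn_integral_cmult)
  also have "(\<integral>\<^sup>+z. ennreal ((norm (fst z))\<^sup>2) \<partial>\<pi>) = (\<integral>\<^sup>+x. ennreal ((norm x)\<^sup>2) \<partial>M)"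
    unfolding fst_pi[symmetric] by (rule nn_integral_distr[symmetric]) simp_all
  also have "(\<integral>\<^sup>+z. ennreal ((norm (snd z))\<^sup>2) \<partial>\<pi>) = (\<integral>\<^sup>+x. ennreal ((norm x)\<^sup>2) \<partial>borel_pmf p)"
    unfolding snd_pi[symmetric] by (rule nn_integral_distr[symmetric]) simp_all
  also have "2 * (\<integral>\<^sup>+x. ennreal ((norm x)\<^sup>2) \<partial>M) + 2 * (\<integral>\<^sup>+x. ennreal ((norm x)\<^sup>2) \<partial>borel_pmf p) < \<infinity>"
  proof -
    have "integrable M (\<lambda>x. (norm x)\<^sup>2)"
      using M by (simp add: finite_second_moment_measures_def)
    then have "(\<integral>\<^sup>+x. ennreal ((norm x)\<^sup>2) \<partial>M) < \<infinity>"
      by (simp add: integrable_iff_bounded)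
    moreover have "(\<integral>\<^sup>+x. ennreal ((norm x)\<^sup>2) \<partial>borel_pmf p) < \<infinity>"
      using p by (subst nn_integral_borel_pmf) (auto simp: ennreal_mult[symmetric])
    ultimately show ?thesis
      by (simp add: ennreal_mult_less_top ennreal_add_less_top)
  qed
  finally show ?thesis .
qed

text \<open>Once the infimum is finite, the conversion to the reals in \<open>W2\<close> loses
  nothing, and a coupling within \<open>e\<close> of the infimum replaces an optimal one.\<close>

lemma W2_coupling:
  fixes p :: "'a::euclidean_space pmf"
  assumes M: "M \<in> finite_second_moment_measures" and p: "finite (set_pmf p)" and e: "0 < e"
  obtains \<pi> where "\<pi> \<in> couplings M (borel_pmf p)"
    "(\<integral>\<^sup>+z. ennreal ((norm (fst z - snd z))\<^sup>2) \<partial>\<pi>) < ennreal ((W2 M (borel_pmf p))\<^sup>2 + e)"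
proof -
  define I where "I = (INF \<pi>\<in>couplings M (borel_pmf p). \<integral>\<^sup>+z. ennreal ((norm (fst z - snd z))\<^sup>2) \<partial>\<pi>)"
  obtain \<pi>0 where "\<pi>0 \<in> couplings M (borel_pmf p)"
    using couplings_nonempty[of M p] M by (auto simp: finite_second_moment_measures_def)
  then have "I < \<infinity>"
    unfolding I_def INF_less_iff using coupling_cost_finite[OF M p] by blast
  then have "I = ennreal ((W2 M (borel_pmf p))\<^sup>2)"
    by (simp add: W2_def I_def[symmetric] less_top)
  also have "\<dots> < ennreal ((W2 M (borel_pmf p))\<^sup>2 + e)"
    using e by (simp add: ennreal_less_iff)
  finally show thesis
    unfolding I_def INF_less_iff using that by blast
qed

text \<open>Relative to the origin \<open>x\<close>, the double sum equals 2 V - 2 |m|^2, where V is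
  the weighted second moment and m the weighted mean. Dropping the square is the only loss; there is
  none if \<open>x\<close> is the mean.\<close>

lemma sum_weighted_pairs_le:
  fixes u :: "'j \<Rightarrow> 'a::real_inner"
  assumes "(\<Sum>p\<in>J. c p) = 1"
  shows "(\<Sum>p\<in>J. \<Sum>q\<in>J. c p * c q * (norm (u p - u q))\<^sup>2) \<le> 2 * (\<Sum>p\<in>J. c p * (norm (x - u p))\<^sup>2)"
proof -
  define b where "b p = u p - x" for p
  define V where "V = (\<Sum>p\<in>J. c p * (norm (b p))\<^sup>2)"
  have "c p * c q * (norm (u p - u q))\<^sup>2 =
      c p * (norm (b p))\<^sup>2 * c q + c p * (c q * (norm (b q))\<^sup>2) - 2 * ((c p *\<^sub>R b p) \<bullet> (c q *\<^sub>R b q))" for p q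
  proof -
    have eq: "u p - u q = b p - b q" by (simp add: b_def)
    show ?thesis
      unfolding eq by (simp add: power2_norm_eq_inner algebra_simps inner_commute)
  qed
  then have "(\<Sum>p\<in>J. \<Sum>q\<in>J. c p * c q * (norm (u p - u q))\<^sup>2) =
      (\<Sum>p\<in>J. \<Sum>q\<in>J. c p * (norm (b p))\<^sup>2 * c q) + (\<Sum>p\<in>J. \<Sum>q\<in>J. c p * (c q * (norm (b q))\<^sup>2))
        - 2 * (\<Sum>p\<in>J. \<Sum>q\<in>J. (c p *\<^sub>R b p) \<bullet> (c q *\<^sub>R b q))"
    by (simp add: sum.distrib sum_subtractf sum_distrib_left)
  also have "(\<Sum>p\<in>J. \<Sum>q\<in>J. c p * (norm (b p))\<^sup>2 * c q) = V"
    using assms unfolding V_def by (simp add: sum_distrib_left[symmetric])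
  also have "(\<Sum>p\<in>J. \<Sum>q\<in>J. c p * (c q * (norm (b q))\<^sup>2)) = V"
    using assms unfolding V_def by (simp add: sum_distrib_left[symmetric] sum_distrib_right[symmetric])
  also have "(\<Sum>p\<in>J. \<Sum>q\<in>J. (c p *\<^sub>R b p) \<bullet> (c q *\<^sub>R b q)) = (norm (\<Sum>p\<in>J. c p *\<^sub>R b p))\<^sup>2"
    by (simp only: power2_norm_eq_inner inner_sum_left inner_sum_right) (rule sum.swap)
  also have "V + V - 2 * (norm (\<Sum>p\<in>J. c p *\<^sub>R b p))\<^sup>2 \<le> 2 * V" by simp
  also have "V = (\<Sum>p\<in>J. c p * (norm (x - u p))\<^sup>2)"
    by (simp add: V_def b_def norm_minus_commute)
  finally show ?thesis .
qed

text \<open>The average over \<open>k\<close> of the costs of the glued plans is an integral over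
  \<open>M\<close> of a double sum over pairs of support points, and there the variance inequality
  applies pointwise. The bound holds up to every positive \<open>e\<close>.\<close>

theorem lp_cost_le_two_phi:
  fixes P :: "'n::finite \<Rightarrow> 'a::euclidean_space pmf"
  assumes alg1: "algorithm1_output (S_org P) P lam Porg y"
    and P: "\<And>i. finite (set_pmf (P i))"
    and lam: "\<And>i. 0 \<le> lam i" "(\<Sum>i\<in>UNIV. lam i) = 1"
    and M: "M \<in> finite_second_moment_measures"
  shows "lp_cost (S_org P) P lam y \<le> 2 * phi P lam M"
proof -
  define C where "C = lp_cost (S_org P) P lam y"
  define J where "J = (SIGMA i:UNIV. set_pmf (P i))"
  have finJ: "finite J" using P by (auto simp: J_def)
  have sumJ: "(\<Sum>i\<in>UNIV. \<Sum>w\<in>set_pmf (P i). h i w) = (\<Sum>p\<in>J. h (fst p) (snd p))"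
    for h :: "'n \<Rightarrow> 'a \<Rightarrow> real"
    unfolding J_def using P by (subst sum.Sigma) (auto simp: case_prod_beta)
  interpret M: prob_space M
    using M by (simp add: finite_second_moment_measures_def)
  have sM [measurable_cong]: "sets M = sets borel"
    using M by (simp add: finite_second_moment_measures_def)
  have "C \<le> 2 * phi P lam M + e" if e: "0 < e" for e
  proof -
    \<comment> \<open>The slack is \<open>e / 2\<close> because the bound is doubled in the
      end.\<close>
    define W where "W i = (W2 M (borel_pmf (P i)))\<^sup>2 + e / 2" for i
    define densities where "densities i f \<longleftrightarrow> (\<forall>w. f w \<in> borel_measurable borel) \<and> (\<forall>w x. 0 \<le> f w x) \<and>
        (AE x in M. (\<Sum>w\<in>set_pmf (P i). f w x) = 1) \<and>
        (\<forall>w\<in>set_pmf (P i). (\<integral>\<^sup>+x. ennreal (f w x) \<partial>M) = ennreal (pmf (P i) w)) \<and>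
        (\<integral>\<^sup>+x. ennreal (\<Sum>w\<in>set_pmf (P i). (norm (x - w))\<^sup>2 * f w x) \<partial>M) < ennreal (W i)"
      for i and f :: "'a \<Rightarrow> 'a \<Rightarrow> real"
    have "\<exists>f. densities i f" for i
    proof -
      obtain \<pi> where \<pi>: "\<pi> \<in> couplings M (borel_pmf (P i))"
        "(\<integral>\<^sup>+z. ennreal ((norm (fst z - snd z))\<^sup>2) \<partial>\<pi>) < ennreal (W i)"
        using W2_coupling[OF M P, of "e / 2" i] e unfolding W_def by auto
      obtain f :: "'a \<Rightarrow> 'a \<Rightarrow> real" where "\<And>w. f w \<in> borel_measurable borel" "\<And>w x. 0 \<le> f w x"
        "AE x in M. (\<Sum>w\<in>set_pmf (P i). f w x) = 1"
        "\<And>w. w \<in> set_pmf (P i) \<Longrightarrow> (\<integral>\<^sup>+x. ennreal (f w x) \<partial>M) = ennreal (pmf (P i) w)"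
        "(\<integral>\<^sup>+z. ennreal ((norm (fst z - snd z))\<^sup>2) \<partial>\<pi>)
           = (\<integral>\<^sup>+x. ennreal (\<Sum>w\<in>set_pmf (P i). (norm (x - w))\<^sup>2 * f w x) \<partial>M)"
        by (rule coupling_disintegration[OF M.prob_space_axioms sM P \<pi>(1)]) (rule that)
      with \<pi>(2) have "densities i f"
        unfolding densities_def by simp
      then show ?thesis by blast
    qed
    then obtain f where "\<And>i. densities i (f i)" by metis
    then have f [measurable]: "\<And>i w. f i w \<in> borel_measurable borel" and f_nonneg: "\<And>i w x. 0 \<le> f i w x"
      and f_sum: "\<And>i. AE x in M. (\<Sum>w\<in>set_pmf (P i). f i w x) = 1"
      and f_mass: "\<And>i w. w \<in> set_pmf (P i) \<Longrightarrow> (\<integral>\<^sup>+x. ennreal (f i w x) \<partial>M) = ennreal (pmf (P i) w)"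
      and f_cost: "\<And>i. (\<integral>\<^sup>+x. ennreal (\<Sum>w\<in>set_pmf (P i). (norm (x - w))\<^sup>2 * f i w x) \<partial>M) < ennreal (W i)"
      by (auto simp: densities_def)
    define c where "c i x = (\<Sum>w\<in>set_pmf (P i). (norm (x - w))\<^sup>2 * f i w x)" for i x
    have [measurable]: "c i \<in> borel_measurable borel" for i
      unfolding c_def by measurable
    have c_nonneg: "0 \<le> c i x" for i x
      unfolding c_def using f_nonneg by (intro sum_nonneg) auto
    have int_c: "integrable M (c i)" for i
      using f_cost[of i] c_nonneg
      by (intro integrableI_bounded) (auto simp: c_def[symmetric] intro: less_trans)
    have c_le: "(\<integral>x. c i x \<partial>M) \<le> W i" for i
    proof -
      have "ennreal (\<integral>x. c i x \<partial>M) = (\<integral>\<^sup>+x. ennreal (c i x) \<partial>M)"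
        using int_c c_nonneg by (intro nn_integral_eq_integral[symmetric]) auto
      also have "\<dots> < ennreal (W i)" using f_cost by (simp add: c_def)
      finally show ?thesis
        using c_nonneg by (subst (asm) ennreal_less_iff) auto
    qed
    \<comment> \<open>Densities bounded by 1 make the products of two of them integrable.\<close>
    have f_le: "AE x in M. f i w x \<le> 1" if "w \<in> set_pmf (P i)" for i w
      using f_sum[of i]
    proof eventually_elim
      case (elim x)
      have "f i w x \<le> (\<Sum>w\<in>set_pmf (P i). f i w x)"
        using that P f_nonneg by (intro member_le_sum) auto
      then show ?case using elim by simp
    qed
    have f_int: "integrable M (f i w)" "(\<integral>x. f i w x \<partial>M) = pmf (P i) w" if "w \<in> set_pmf (P i)" for i w
    proof -
      show "integrable M (f i w)"
        using f_mass[OF that] f_nonneg by (intro integrableI_bounded) auto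
      show "(\<integral>x. f i w x \<partial>M) = pmf (P i) w"
        using f_mass[OF that] f_nonneg by (subst integral_eq_nn_integral) auto
    qed
    have ff_int: "integrable M (\<lambda>x. f k v x * f i w x)"
      if "v \<in> set_pmf (P k)" "w \<in> set_pmf (P i)" for k i v w
    proof (rule Bochner_Integration.integrable_bound[OF f_int(1)[OF that(1)]])
      show "AE x in M. norm (f k v x * f i w x) \<le> norm (f k v x)"
        using f_le[OF that(2)] by eventually_elim (simp add: abs_mult f_nonneg mult_left_le)
    qed measurable
    \<comment> \<open>Given \<open>x\<close>, the points \<open>v\<close> and \<open>w\<close> are
      chosen independently with probabilities \<open>f k v x\<close> and \<open>f i w x\<close>;
      averaging over \<open>M\<close> gives a coupling of \<open>P k\<close> and
      \<open>P i\<close>.\<close>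
    define g where "g k i v w = (\<integral>x. f k v x * f i w x \<partial>M)" for k i v w
    have g_commute: "g k i v w = g i k w v" for k i v w
      by (simp add: g_def mult.commute)
    have g_nonneg: "0 \<le> g k i v w" for k i v w
      unfolding g_def using f_nonneg by (intro integral_nonneg_AE) auto
    have g_row: "(\<Sum>w\<in>set_pmf (P i). g k i v w) = pmf (P k) v" if v: "v \<in> set_pmf (P k)" for k i v
    proof -
      have "(\<Sum>w\<in>set_pmf (P i). g k i v w) = (\<integral>x. (\<Sum>w\<in>set_pmf (P i). f k v x * f i w x) \<partial>M)"
        unfolding g_def using ff_int[OF v] by (intro Bochner_Integration.integral_sum[symmetric]) auto
      also have "\<dots> = (\<integral>x. f k v x \<partial>M)"
      proof (rule integral_cong_AE)
        show "AE x in M. (\<Sum>w\<in>set_pmf (P i). f k v x * f i w x) = f k v x"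
          using f_sum[of i] by eventually_elim (simp add: sum_distrib_left[symmetric])
      qed measurable
      finally show ?thesis using f_int[OF v] by simp
    qed
    \<comment> \<open>For fixed \<open>k\<close> the plans \<open>g k i\<close> move
      \<open>P k\<close> to all \<open>P i\<close>. Extended by 0 to \<open>S_org P\<close> they are
      feasible for the linear program, with \<open>P k\<close> in the role of the approximate
      barycenter.\<close>
    have C_le: "C \<le> (\<Sum>i\<in>UNIV. lam i * (\<Sum>v\<in>set_pmf (P k). \<Sum>w\<in>set_pmf (P i). (norm (v - w))\<^sup>2 * g k i v w))" for k
    proof -
      define g' where "g' i v w = (if v \<in> set_pmf (P k) then g k i v w else 0)" for i v w
      have Sk: "set_pmf (P k) \<subseteq> S_org P" by (auto simp: S_org_def)
      have finS: "finite (S_org P)" using P by (simp add: S_org_def)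
      have "C \<le> transport_cost (S_org P) P lam g'"
        unfolding C_def
      proof (rule algorithm1_optimal[OF alg1 finS P, where z = "pmf (P k)"])
        fix i v assume "v \<in> S_org P"
        show "(\<Sum>w\<in>set_pmf (P i). g' i v w) = pmf (P k) v"
          using g_row[of v k i] by (cases "v \<in> set_pmf (P k)") (auto simp: g'_def set_pmf_iff)
      next
        fix i w assume w: "w \<in> set_pmf (P i)"
        \<comment> \<open>By symmetry, a column sum of \<open>g k i\<close> is a row sum of
          \<open>g i k\<close>.\<close>
        have "(\<Sum>v\<in>S_org P. g' i v w) = (\<Sum>v\<in>set_pmf (P k). g i k w v)"
          unfolding g'_def using finS Sk by (subst g_commute) (simp add: sum.If_cases Int_absorb1 Int_commute)
        then show "(\<Sum>v\<in>S_org P. g' i v w) = pmf (P i) w"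
          using g_row[OF w] by simp
      qed (auto simp: g'_def g_nonneg)
      also have "transport_cost (S_org P) P lam g' =
          (\<Sum>i\<in>UNIV. lam i * (\<Sum>v\<in>set_pmf (P k). \<Sum>w\<in>set_pmf (P i). (norm (v - w))\<^sup>2 * g k i v w))"
        unfolding transport_cost_def
        using Sk finS by (intro sum.cong arg_cong2[where f = "(*)"] sum.mono_neutral_cong_right) (auto simp: g'_def)
      finally show ?thesis .
    qed
    \<comment> \<open>The pairs in \<open>J\<close> enumerate the support points of all
      \<open>P i\<close> with multiplicity. For almost every \<open>x\<close> the weights
      \<open>L p * F p x\<close> have total 1, which is what the variance inequality asks
      for.\<close>
    define F where "F p = f (fst p) (snd p)" for p
    define L where "L p = lam (fst p)" for p :: "'n \<times> 'a"
    have "C = (\<Sum>k\<in>UNIV. lam k * C)"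
      using lam(2) by (simp add: sum_distrib_right[symmetric])
    also have "\<dots> \<le> (\<Sum>k\<in>UNIV. lam k *
        (\<Sum>i\<in>UNIV. lam i * (\<Sum>v\<in>set_pmf (P k). \<Sum>w\<in>set_pmf (P i). (norm (v - w))\<^sup>2 * g k i v w)))"
      using lam(1) C_le by (intro sum_mono mult_left_mono) auto
    also have "\<dots> = (\<Sum>k\<in>UNIV. \<Sum>v\<in>set_pmf (P k). \<Sum>i\<in>UNIV. \<Sum>w\<in>set_pmf (P i).
        lam k * lam i * (norm (v - w))\<^sup>2 * g k i v w)"
      by (subst (2) sum.swap) (simp add: sum_distrib_left mult.assoc)
    also have "\<dots> = (\<Sum>p\<in>J. \<Sum>q\<in>J. L p * L q * (norm (snd p - snd q))\<^sup>2 * g (fst p) (fst q) (snd p) (snd q))"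
      by (simp only: sumJ L_def)
    also have "\<dots> = (\<Sum>p\<in>J. \<Sum>q\<in>J. \<integral>x. L p * L q * (norm (snd p - snd q))\<^sup>2 * (F p x * F q x) \<partial>M)"
      by (simp add: g_def F_def)
    also have "\<dots> = (\<Sum>p\<in>J. \<integral>x. (\<Sum>q\<in>J. L p * L q * (norm (snd p - snd q))\<^sup>2 * (F p x * F q x)) \<partial>M)"
      using ff_int
      by (intro sum.cong refl Bochner_Integration.integral_sum[symmetric] integrable_mult_right)
        (auto simp: F_def J_def)
    also have "\<dots> = (\<integral>x. (\<Sum>p\<in>J. \<Sum>q\<in>J. L p * L q * (norm (snd p - snd q))\<^sup>2 * (F p x * F q x)) \<partial>M)"
      using ff_int
      by (intro Bochner_Integration.integral_sum[symmetric] Bochner_Integration.integrable_sum integrable_mult_right)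
        (auto simp: F_def J_def)
    also have "\<dots> \<le> (\<integral>x. 2 * (\<Sum>i\<in>UNIV. lam i * c i x) \<partial>M)"
    proof (rule integral_mono_AE)
      show "integrable M (\<lambda>x. \<Sum>p\<in>J. \<Sum>q\<in>J. L p * L q * (norm (snd p - snd q))\<^sup>2 * (F p x * F q x))"
        using ff_int
        by (intro Bochner_Integration.integrable_sum integrable_mult_right) (auto simp: F_def J_def)
      show "integrable M (\<lambda>x. 2 * (\<Sum>i\<in>UNIV. lam i * c i x))"
        using int_c by auto
      have "AE x in M. \<forall>i. (\<Sum>w\<in>set_pmf (P i). f i w x) = 1"
        using f_sum by (simp add: AE_all_countable)
      then show "AE x in M. (\<Sum>p\<in>J. \<Sum>q\<in>J. L p * L q * (norm (snd p - snd q))\<^sup>2 * (F p x * F q x))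
          \<le> 2 * (\<Sum>i\<in>UNIV. lam i * c i x)"
      proof eventually_elim
        case (elim x)
        have "(\<Sum>p\<in>J. L p * F p x) = 1"
          using elim lam(2) sumJ[of "\<lambda>i w. lam i * f i w x"]
          by (simp add: L_def F_def sum_distrib_left[symmetric])
        note sum_weighted_pairs_le[OF this, of snd x]
        also have "(\<Sum>p\<in>J. L p * F p x * (norm (x - snd p))\<^sup>2) = (\<Sum>i\<in>UNIV. lam i * c i x)"
          using sumJ[of "\<lambda>i w. lam i * f i w x * (norm (x - w))\<^sup>2"]
          by (simp add: L_def F_def c_def sum_distrib_left mult_ac)
        finally show ?case by (simp add: mult_ac)
      qed
    qed
    also have "\<dots> = 2 * (\<Sum>i\<in>UNIV. lam i * (\<integral>x. c i x \<partial>M))"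
      using int_c by simp
    also have "\<dots> \<le> 2 * (\<Sum>i\<in>UNIV. lam i * W i)"
      using c_le lam(1) by (intro mult_left_mono sum_mono) auto
    also have "\<dots> = 2 * phi P lam M + e"
    proof -
      have "(\<Sum>i\<in>UNIV. lam i * W i) = phi P lam M + (\<Sum>i\<in>UNIV. lam i) * (e / 2)"
        by (simp only: W_def phi_def distrib_left sum.distrib sum_distrib_right)
      then show ?thesis using lam(2) by simp
    qed
    finally show ?thesis .
  qed
  then show ?thesis
    unfolding C_def by (rule field_le_epsilon)
qed


section \<open>Merging and splitting\<close>

lemma lex_less_irrefl: "\<not> lex_less x x"
  by (simp add: lex_less_def)

lemma lex_less_trans:
  assumes "lex_less x y" "lex_less y z"
  shows "lex_less x z"
proof -
  obtain k where k: "\<forall>j<k. x $ j = y $ j" "x $ k < y $ k"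
    using assms(1) by (auto simp: lex_less_def)
  obtain k' where k': "\<forall>j<k'. y $ j = z $ j" "y $ k' < z $ k'"
    using assms(2) by (auto simp: lex_less_def)
  show ?thesis
    unfolding lex_less_def
  proof (intro exI[of _ "min k k'"] conjI allI impI)
    show "x $ j = z $ j" if "j < min k k'" for j
      using that k k' by simp
    show "x $ min k k' < z $ min k k'"
      using k k' by (cases k k' rule: linorder_cases) (auto simp: min_def)
  qed
qed

lemma lex_less_total:
  assumes "x \<noteq> y"
  shows "lex_less x y \<or> lex_less y x"
proof -
  define D where "D = {k. x $ k \<noteq> y $ k}"
  have D: "finite D" "D \<noteq> {}" using assms by (auto simp: D_def vec_eq_iff)
  have "x $ j = y $ j" if "j < Min D" for j
  proof -
    have "j \<notin> D" using that Min_le[OF D(1), of j] by (metis not_le)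
    then show ?thesis by (simp add: D_def)
  qed
  moreover have "x $ Min D \<noteq> y $ Min D"
    using Min_in[OF D] by (auto simp: D_def)
  ultimately show ?thesis
    unfolding lex_less_def by (metis linorder_neqE)
qed

lemma lex_max_exists:
  assumes "finite A" "A \<noteq> {}"
  shows "\<exists>x. lex_max A x"
  using assms
proof (induction A rule: finite_ne_induct)
  case (singleton x)
  then show ?case by (auto simp: lex_max_def)
next
  case (insert x A)
  then obtain m where m: "lex_max A m" by blast
  show ?case
  proof (cases "lex_less m x")
    case True
    then have "lex_max (insert x A) x"
      using m unfolding lex_max_def by (metis insert_iff lex_less_trans)
    then show ?thesis by blast
  next
    case False
    then have "lex_max (insert x A) m"
      using m lex_less_total[of m x] by (auto simp: lex_max_def)
    then show ?thesis by blast
  qed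
qed

text \<open>Take the first coordinate \<open>k\<close> in which any of the pairs differs. The first
  difference within a pair is at \<open>k\<close> or later, so at \<open>k\<close> every comparison
  is weak in the right direction and one is strict; positive weights preserve this.\<close>

lemma lex_less_weighted_mean:
  fixes x y :: "'n::finite \<Rightarrow> 'd::{finite,linorder} point"
  assumes lam: "\<And>i. 0 < lam i"
    and le: "\<And>i. x i = y i \<or> lex_less (x i) (y i)"
    and neq: "\<exists>i. x i \<noteq> y i"
  shows "lex_less (weighted_mean lam x) (weighted_mean lam y)"
proof -
  define D where "D = {k. \<exists>i. x i $ k \<noteq> y i $ k}"
  have D: "finite D" "D \<noteq> {}" using neq by (auto simp: D_def vec_eq_iff)
  define k where "k = Min D"
  have before: "x i $ j = y i $ j" if "j < k" for i j
  proof -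
    have "j \<notin> D" using that Min_le[OF D(1), of j] by (metis k_def not_le)
    then show ?thesis by (simp add: D_def)
  qed
  have at: "x i $ k \<le> y i $ k" for i
  proof (cases "x i = y i")
    case False
    then obtain m where m: "\<forall>j<m. x i $ j = y i $ j" "x i $ m < y i $ m"
      using le[of i] by (auto simp: lex_less_def)
    then have "m \<in> D" by (auto simp: D_def intro!: exI[of _ i])
    then have "k \<le> m" using Min_le[OF D(1)] by (simp add: k_def)
    then show ?thesis using m by (cases "k = m") auto
  qed simp
  have "\<exists>i. x i $ k \<noteq> y i $ k"
    using Min_in[OF D] by (auto simp: D_def k_def)
  then have "\<exists>i. x i $ k < y i $ k" using at by (metis order_le_less)
  then have "(\<Sum>i\<in>UNIV. lam i * x i $ k) < (\<Sum>i\<in>UNIV. lam i * y i $ k)"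
    using lam at by (intro sum_strict_mono_ex1) (auto intro: mult_left_mono less_imp_le)
  moreover have "weighted_mean lam z $ j = (\<Sum>i\<in>UNIV. lam i * z i $ j)"
    for z :: "'n \<Rightarrow> 'd point" and j
    by (simp add: weighted_mean_def)
  ultimately show ?thesis
    unfolding lex_less_def using before by (intro exI[of _ k] conjI allI impI) simp_all
qed

text \<open>The parallel axis theorem: the cross term vanishes at the mean. It gives both the cost
  of serving a tuple from another point and the gain from moving a point to the mean of its
  tuple.\<close>

lemma sum_weighted_dist_decomposition:
  fixes q :: "'n::finite \<Rightarrow> 'a::real_inner"
  assumes "(\<Sum>i\<in>UNIV. lam i) = 1"
  shows "(\<Sum>i\<in>UNIV. lam i * (norm (a - q i))\<^sup>2) =
    (norm (a - weighted_mean lam q))\<^sup>2 + (\<Sum>i\<in>UNIV. lam i * (norm (weighted_mean lam q - q i))\<^sup>2)"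
proof -
  define c where "c = weighted_mean lam q"
  have "lam i * (norm (a - q i))\<^sup>2 = lam i * (norm (a - c))\<^sup>2 + lam i * (norm (c - q i))\<^sup>2
      + 2 * ((a - c) \<bullet> (lam i *\<^sub>R c - lam i *\<^sub>R q i))" for i
    by (simp add: power2_norm_eq_inner algebra_simps inner_commute)
  then have "(\<Sum>i\<in>UNIV. lam i * (norm (a - q i))\<^sup>2) = (\<Sum>i\<in>UNIV. lam i * (norm (a - c))\<^sup>2)
      + (\<Sum>i\<in>UNIV. lam i * (norm (c - q i))\<^sup>2)
      + 2 * ((a - c) \<bullet> ((\<Sum>i\<in>UNIV. lam i *\<^sub>R c) - (\<Sum>i\<in>UNIV. lam i *\<^sub>R q i)))"
    by (simp add: sum.distrib sum_distrib_left[symmetric] inner_sum_right[symmetric] sum_subtractf)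
  also have "(\<Sum>i\<in>UNIV. lam i *\<^sub>R c) = c"
    using assms by (simp add: scaleR_sum_left[symmetric])
  also have "(\<Sum>i\<in>UNIV. lam i * (norm (a - c))\<^sup>2) = (norm (a - c))\<^sup>2"
    using assms by (simp add: sum_distrib_right[symmetric])
  finally show ?thesis by (simp add: c_def weighted_mean_def)
qed

section \<open>Adding and removing mass along a tuple\<close>

lemma sum_mult_add_mass:
  fixes h :: "'a \<Rightarrow> real"
  assumes "finite A" "q i \<in> A"
  shows "(\<Sum>x\<in>A. h x * add_mass p q t i x) = (\<Sum>x\<in>A. h x * p i x) + h (q i) * t"
proof -
  have "(\<Sum>x\<in>A. h x * add_mass p q t i x) = (\<Sum>x\<in>A. h x * p i x + (if x = q i then h (q i) * t else 0))"
    by (intro sum.cong) (auto simp: add_mass_def algebra_simps)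
  then show ?thesis using assms by (simp add: sum.distrib)
qed

lemma sum_add_mass:
  assumes "finite A" "q i \<in> A"
  shows "(\<Sum>x\<in>A. add_mass p q t i x) = (\<Sum>x\<in>A. p i x) + t"
  using sum_mult_add_mass[where q = q and i = i, OF assms, of "\<lambda>_. 1" p t] by simp

lemma d_min_le: "d_min p q \<le> p i (q i)"
  by (simp add: d_min_def)

lemma d_min_attained: "\<exists>i. p i (q i) = d_min p q"
proof -
  have "d_min p q \<in> range (\<lambda>i. p i (q i))"
    unfolding d_min_def by (rule Min_in) auto
  then show ?thesis by auto
qed

lemma d_min_pos:
  assumes "\<And>i. q i \<in> msupp (p i)"
  shows "0 < d_min p q"
proof -
  obtain i where "p i (q i) = d_min p q" using d_min_attained by blast
  then show ?thesis using assms[of i] by (simp add: msupp_def)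
qed

lemma remove_mass_nonneg: "0 \<le> p i x \<Longrightarrow> 0 \<le> add_mass p q (- d_min p q) i x"
  using d_min_le[of p q i] by (auto simp: add_mass_def)

lemma msupp_remove_mass_subset:
  "(\<And>i. q i \<in> msupp (p i)) \<Longrightarrow> msupp (add_mass p q (- d_min p q) i) \<subseteq> msupp (p i)"
  using d_min_pos[of q p] by (auto simp: add_mass_def msupp_def split: if_splits)

lemma msupp_remove_mass_removes:
  "\<exists>i. q i \<notin> msupp (add_mass p q (- d_min p q) i)"
proof -
  obtain i where "p i (q i) = d_min p q" using d_min_attained by blast
  then have "add_mass p q (- d_min p q) i (q i) = 0" by (simp add: add_mass_def)
  then show ?thesis by (intro exI[of _ i]) (simp add: msupp_def)
qed

text \<open>The minimum \<open>d_min\<close> is attained at some \<open>i\<close>, whose chosen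
  point is thereby exhausted, while no support grows. This drop bounds the number of tuples per
  point and ends the inner loops of both steps.\<close>

lemma sum_card_msupp_remove_mass:
  assumes "\<And>i. finite (msupp (p i))" "\<And>i. q i \<in> msupp (p i)"
  shows "(\<Sum>i\<in>UNIV. card (msupp (add_mass p q (- d_min p q) i))) < (\<Sum>i\<in>UNIV. card (msupp (p i)))"
proof (rule sum_strict_mono_ex1)
  note sub = msupp_remove_mass_subset[of q p, OF assms(2)]
  show "\<forall>i\<in>UNIV. card (msupp (add_mass p q (- d_min p q) i)) \<le> card (msupp (p i))"
    using assms(1) sub by (simp add: card_mono)
  obtain i where "q i \<notin> msupp (add_mass p q (- d_min p q) i)"
    using msupp_remove_mass_removes by blast
  then have "msupp (add_mass p q (- d_min p q) i) \<subset> msupp (p i)"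
    using sub assms(2) by blast
  then show "\<exists>i\<in>UNIV. card (msupp (add_mass p q (- d_min p q) i)) < card (msupp (p i))"
    using assms(1) by (blast intro: psubset_card_mono)
qed simp

lemma msupp_nonempty_if_sum_pos:
  assumes "0 < (\<Sum>x\<in>A. m x)"
  shows "msupp m \<noteq> {}"
proof
  assume "msupp m = {}"
  then have "(\<Sum>x\<in>A. m x) \<le> 0" by (intro sum_nonpos) (auto simp: msupp_def not_less)
  then show False using assms by simp
qed

text \<open>A transport from the points \<open>s 1, ..., s r\<close>, indexed by position. A mass
  \<open>d k\<close> may be 0, so the positions stay the same while merging empties some of
  them.\<close>

definition feasible_masses ::
  "('n \<Rightarrow> 'a pmf) \<Rightarrow> nat \<Rightarrow> (nat \<Rightarrow> real) \<Rightarrow> (nat \<Rightarrow> 'n \<Rightarrow> 'a \<Rightarrow> real) \<Rightarrow> bool"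
where
  "feasible_masses P r d p \<longleftrightarrow>
     (\<forall>k\<in>{1..r}. \<forall>i x. 0 \<le> p k i x) \<and>
     (\<forall>k\<in>{1..r}. \<forall>i x. x \<notin> set_pmf (P i) \<longrightarrow> p k i x = 0) \<and>
     (\<forall>k\<in>{1..r}. \<forall>i. (\<Sum>x\<in>set_pmf (P i). p k i x) = d k) \<and>
     (\<forall>i. \<forall>w\<in>set_pmf (P i). (\<Sum>k=1..r. p k i w) = pmf (P i) w)"

definition masses_cost ::
  "('n::finite \<Rightarrow> 'a::real_normed_vector pmf) \<Rightarrow> ('n \<Rightarrow> real) \<Rightarrow> (nat \<Rightarrow> 'a) \<Rightarrow> nat \<Rightarrow>
   (nat \<Rightarrow> 'n \<Rightarrow> 'a \<Rightarrow> real) \<Rightarrow> real"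
where
  "masses_cost P lam s r p =
     (\<Sum>i\<in>UNIV. lam i * (\<Sum>k=1..r. \<Sum>w\<in>set_pmf (P i). (norm (s k - w))\<^sup>2 * p k i w))"

text \<open>\<open>C\<close> stands for the optimal value of the linear program. All that the
  analysis of a run takes from the program is that no family of partial measures on the fixed points
  \<open>s 1, ..., s r\<close> is cheaper.\<close>

locale optimal_masses =
  fixes P :: "'n::finite \<Rightarrow> ('d::{finite,linorder} point) pmf"
    and lam :: "'n \<Rightarrow> real" and s :: "nat \<Rightarrow> 'd point" and r :: nat and C :: real
  assumes finite_P: "\<And>i. finite (set_pmf (P i))"
    and lam_pos: "\<And>i. 0 < lam i"
    and lam_sum: "(\<Sum>i\<in>UNIV. lam i) = 1"
    and optimal: "\<And>d p. feasible_masses P r d p \<Longrightarrow> C \<le> masses_cost P lam s r p"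
begin

abbreviation "feasible \<equiv> feasible_masses P r"
abbreviation "cost \<equiv> masses_cost P lam s r"

section \<open>Moving a tuple between two points, and what optimality says about it\<close>

lemma msupp_feasible:
  assumes "feasible d p" "k \<in> {1..r}"
  shows "msupp (p k i) \<subseteq> set_pmf (P i)" "finite (msupp (p k i))"
proof -
  show sub: "msupp (p k i) \<subseteq> set_pmf (P i)"
  proof
    fix x assume "x \<in> msupp (p k i)"
    then have "p k i x \<noteq> 0" by (simp add: msupp_def)
    then show "x \<in> set_pmf (P i)"
      using assms unfolding feasible_masses_def by blast
  qed
  show "finite (msupp (p k i))"
    by (rule finite_subset[OF sub finite_P])
qed

text \<open>The update performed by a merge, named on its own because optimality is also tested
  against moves that the algorithm does not make.\<close>

definition moved :: "nat \<Rightarrow> nat \<Rightarrow> ('n \<Rightarrow> 'd point) \<Rightarrow> real \<Rightarrow> (nat \<Rightarrow> 'n \<Rightarrow> 'd point \<Rightarrow> real) \<Rightarrow>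
    nat \<Rightarrow> 'n \<Rightarrow> 'd point \<Rightarrow> real" where
  "moved l j q t p = p(l := add_mass (p l) q (- t), j := add_mass (p j) q t)"

text \<open>Constant \<open>h\<close> shows that column sums are kept; squared distances to
  \<open>w\<close> as \<open>h\<close> give the change of cost.\<close>

lemma sum_moved:
  fixes h :: "nat \<Rightarrow> real"
  assumes "l \<in> {1..r}" "j \<in> {1..r}" "l \<noteq> j"
  shows "(\<Sum>k=1..r. h k * moved l j q t p k i w) =
    (\<Sum>k=1..r. h k * p k i w) + (if w = q i then t * (h j - h l) else 0)"
proof -
  have "(\<Sum>k=1..r. h k * moved l j q t p k i w) = (\<Sum>k=1..r. h k * p k i w +
      ((if k = j then if w = q i then h j * t else 0 else 0) - (if k = l then if w = q i then h l * t else 0 else 0)))"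
    using assms(3) by (intro sum.cong) (auto simp: moved_def add_mass_def algebra_simps)
  then show ?thesis
    using assms by (cases "w = q i") (simp_all add: sum.distrib sum_subtractf algebra_simps)
qed

lemma feasible_moved:
  assumes feas: "feasible d p" and lj: "l \<in> {1..r}" "j \<in> {1..r}" "l \<noteq> j"
    and q: "\<And>i. q i \<in> msupp (p l i)"
  defines "t \<equiv> d_min (p l) q"
  shows "feasible (d(l := d l - t, j := d j + t)) (moved l j q t p)"
proof -
  have qP: "q i \<in> set_pmf (P i)" for i using q msupp_feasible(1)[OF feas lj(1)] by blast
  have t: "0 < t" unfolding t_def by (rule d_min_pos[of q "p l", OF q])
  note F = feas[unfolded feasible_masses_def]
  have moved_eq: "moved l j q t p k = (if k = j then add_mass (p j) q t
      else if k = l then add_mass (p l) q (- t) else p k)" for k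
    by (simp add: moved_def)
  show ?thesis
    unfolding feasible_masses_def
  proof (intro conjI ballI allI impI)
    fix k i x assume k: "k \<in> {1..r}"
    then have p: "0 \<le> p k i x" using F by blast
    have "0 \<le> add_mass (p k) q t i x"
      using p t by (auto simp: add_mass_def)
    moreover have "0 \<le> add_mass (p l) q (- t) i x" if "k = l"
      using p that remove_mass_nonneg[of "p l" i x q] by (simp add: t_def)
    ultimately show "0 \<le> moved l j q t p k i x"
      using p by (auto simp: moved_eq)
  next
    fix k i x assume "k \<in> {1..r}" "x \<notin> set_pmf (P i)"
    moreover from this have "p k i x = 0" "x \<noteq> q i" using F qP[of i] by blast+
    ultimately show "moved l j q t p k i x = 0"
      by (auto simp: moved_eq add_mass_def)
  next
    fix k i assume "k \<in> {1..r}"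
    then have "(\<Sum>x\<in>set_pmf (P i). p k i x) = d k" using F by blast
    then show "(\<Sum>x\<in>set_pmf (P i). moved l j q t p k i x) = (d(l := d l - t, j := d j + t)) k"
      by (auto simp: moved_eq sum_add_mass[where q = q, OF finite_P qP])
  next
    fix i w assume "w \<in> set_pmf (P i)"
    then have "(\<Sum>k=1..r. p k i w) = pmf (P i) w" using F by blast
    then show "(\<Sum>k=1..r. moved l j q t p k i w) = pmf (P i) w"
      using sum_moved[OF lj, of "\<lambda>_. 1" q t p i w] by simp
  qed
qed

text \<open>The spread of the tuple around its mean is the same for both points and cancels, so only
  the distances of the mean remain. This is why the algorithm tests the mean: an equidistant tuple
  is merged at no cost.\<close>

lemma cost_moved:
  assumes lj: "l \<in> {1..r}" "j \<in> {1..r}" "l \<noteq> j" and q: "\<And>i. q i \<in> set_pmf (P i)"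
  shows "cost (moved l j q t p) =
    cost p + t * ((norm (weighted_mean lam q - s j))\<^sup>2 - (norm (weighted_mean lam q - s l))\<^sup>2)"
proof -
  have "(\<Sum>k=1..r. \<Sum>w\<in>set_pmf (P i). (norm (s k - w))\<^sup>2 * moved l j q t p k i w) =
      (\<Sum>k=1..r. \<Sum>w\<in>set_pmf (P i). (norm (s k - w))\<^sup>2 * p k i w)
      + t * ((norm (s j - q i))\<^sup>2 - (norm (s l - q i))\<^sup>2)" for i
  proof -
    have "(\<Sum>k=1..r. \<Sum>w\<in>set_pmf (P i). (norm (s k - w))\<^sup>2 * moved l j q t p k i w) =
        (\<Sum>w\<in>set_pmf (P i). \<Sum>k=1..r. (norm (s k - w))\<^sup>2 * moved l j q t p k i w)"
      by (rule sum.swap)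
    also have "\<dots> = (\<Sum>w\<in>set_pmf (P i). (\<Sum>k=1..r. (norm (s k - w))\<^sup>2 * p k i w)
          + (if w = q i then t * ((norm (s j - w))\<^sup>2 - (norm (s l - w))\<^sup>2) else 0))"
      by (simp only: sum_moved[OF lj])
    also have "\<dots> = (\<Sum>w\<in>set_pmf (P i). \<Sum>k=1..r. (norm (s k - w))\<^sup>2 * p k i w)
          + t * ((norm (s j - q i))\<^sup>2 - (norm (s l - q i))\<^sup>2)"
      using finite_P q by (simp add: sum.distrib)
    also have "(\<Sum>w\<in>set_pmf (P i). \<Sum>k=1..r. (norm (s k - w))\<^sup>2 * p k i w) =
        (\<Sum>k=1..r. \<Sum>w\<in>set_pmf (P i). (norm (s k - w))\<^sup>2 * p k i w)"
      by (rule sum.swap)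
    finally show ?thesis .
  qed
  then have "cost (moved l j q t p) = cost p + (\<Sum>i\<in>UNIV. lam i * (t * ((norm (s j - q i))\<^sup>2 - (norm (s l - q i))\<^sup>2)))"
    by (simp add: masses_cost_def distrib_left sum.distrib)
  also have "(\<Sum>i\<in>UNIV. lam i * (t * ((norm (s j - q i))\<^sup>2 - (norm (s l - q i))\<^sup>2))) =
      t * ((\<Sum>i\<in>UNIV. lam i * (norm (s j - q i))\<^sup>2) - (\<Sum>i\<in>UNIV. lam i * (norm (s l - q i))\<^sup>2))"
    by (simp add: sum_distrib_left sum_subtractf algebra_simps)
  also have "(\<Sum>i\<in>UNIV. lam i * (norm (s j - q i))\<^sup>2) - (\<Sum>i\<in>UNIV. lam i * (norm (s l - q i))\<^sup>2) =
      (norm (weighted_mean lam q - s j))\<^sup>2 - (norm (weighted_mean lam q - s l))\<^sup>2"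
    using sum_weighted_dist_decomposition[OF lam_sum, of "s j" q]
      sum_weighted_dist_decomposition[OF lam_sum, of "s l" q]
    by (simp only: norm_minus_commute[of "weighted_mean lam q" "s j"]
        norm_minus_commute[of "weighted_mean lam q" "s l"])
  finally show ?thesis .
qed

text \<open>Otherwise moving the positive mass \<open>d_min\<close> of this tuple to
  \<open>s j\<close> would beat the optimal cost.\<close>

lemma mean_closest:
  assumes "feasible d p" "cost p = C" and lj: "l \<in> {1..r}" "j \<in> {1..r}"
    and q: "\<And>i. q i \<in> msupp (p l i)"
  shows "(norm (weighted_mean lam q - s l))\<^sup>2 \<le> (norm (weighted_mean lam q - s j))\<^sup>2"
proof (cases "l = j")
  case False
  let ?t = "d_min (p l) q"
  have "C \<le> cost (moved l j q ?t p)"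
    using optimal feasible_moved[OF assms(1) lj False q] by blast
  moreover have "q i \<in> set_pmf (P i)" for i
    using q msupp_feasible(1)[OF assms(1) lj(1)] by blast
  ultimately have "0 \<le> ?t * ((norm (weighted_mean lam q - s j))\<^sup>2 - (norm (weighted_mean lam q - s l))\<^sup>2)"
    using cost_moved[OF lj False, of q ?t p] assms(2) by simp
  moreover have "0 < ?t" by (rule d_min_pos[of q "p l", OF q])
  ultimately have "0 \<le> (norm (weighted_mean lam q - s j))\<^sup>2 - (norm (weighted_mean lam q - s l))\<^sup>2"
    using mult_pos_neg[of ?t] by (meson not_less)
  then show ?thesis by linarith
qed simp

text \<open>The condition ranges over all tuples that could be formed, not only those the algorithm
  picks. It is vacuous once some support at \<open>l\<close> is empty, which covers points that have
  lost all their mass.\<close>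

definition strictly_closer :: "(nat \<Rightarrow> 'n \<Rightarrow> 'd point \<Rightarrow> real) \<Rightarrow> nat \<Rightarrow> nat \<Rightarrow> bool" where
  "strictly_closer p l j \<longleftrightarrow> (\<forall>q. (\<forall>i. q i \<in> msupp (p l i)) \<longrightarrow>
     (norm (weighted_mean lam q - s l))\<^sup>2 < (norm (weighted_mean lam q - s j))\<^sup>2)"

lemma strictly_closer_mono:
  assumes "strictly_closer p l j" "\<And>i. msupp (p' l i) \<subseteq> msupp (p l i)"
  shows "strictly_closer p' l j"
  unfolding strictly_closer_def
proof (intro allI impI)
  fix q assume "\<forall>i. q i \<in> msupp (p' l i)"
  then have "\<forall>i. q i \<in> msupp (p l i)" using assms(2) by (auto dest: subsetD)
  then show "(norm (weighted_mean lam q - s l))\<^sup>2 < (norm (weighted_mean lam q - s j))\<^sup>2"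
    using assms(1) by (simp add: strictly_closer_def)
qed

text \<open>With \<open>u = s j - s l\<close>, a tuple comes nearer to a tie the larger its mean is
  in direction \<open>u\<close>, so the chosen maximizers form the most critical tuple. For it
  optimality gives the weak inequality and the failed test excludes equality.\<close>

lemma strictly_closer_if_argmax:
  assumes feas: "feasible d p" "cost p = C" and lj: "l \<in> {1..r}" "j \<in> {1..r}"
    and q: "\<And>i. is_arg_max (\<lambda>x. (s j - s l) \<bullet> x) (\<lambda>x. x \<in> msupp (p l i)) (q i)"
    and neq: "(norm (weighted_mean lam q - s j))\<^sup>2 \<noteq> (norm (weighted_mean lam q - s l))\<^sup>2"
  shows "strictly_closer p l j"
  unfolding strictly_closer_def
proof (intro allI impI)
  fix q' assume q': "\<forall>i. q' i \<in> msupp (p l i)"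
  define u where "u = s j - s l"
  have diff: "(norm (c - s j))\<^sup>2 - (norm (c - s l))\<^sup>2 = s j \<bullet> s j - s l \<bullet> s l - 2 * (u \<bullet> c)" for c
    unfolding u_def by (simp add: power2_norm_eq_inner algebra_simps inner_commute)
  have "u \<bullet> q' i \<le> u \<bullet> q i" for i
    using q[of i] q' by (auto simp: is_arg_max_def u_def not_less)
  then have "u \<bullet> weighted_mean lam q' \<le> u \<bullet> weighted_mean lam q"
    unfolding weighted_mean_def inner_sum_right inner_scaleR_right
    using lam_pos by (intro sum_mono mult_left_mono) (auto intro: less_imp_le)
  moreover have "(norm (weighted_mean lam q - s l))\<^sup>2 \<le> (norm (weighted_mean lam q - s j))\<^sup>2"
    using q by (intro mean_closest[OF feas lj]) (simp add: is_arg_max_def)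
  ultimately show "(norm (weighted_mean lam q' - s l))\<^sup>2 < (norm (weighted_mean lam q' - s j))\<^sup>2"
    using neq diff[of "weighted_mean lam q"] diff[of "weighted_mean lam q'"] by linarith
qed

text \<open>A common mean would be strictly closer to the point with the larger index, by the
  outcome of merging, yet no farther from the one with the smaller index, by optimality.\<close>

lemma means_differ:
  assumes feas: "feasible d p" "cost p = C" and lj: "l \<in> {1..r}" "j \<in> {1..r}" "l \<noteq> j"
    and strict: "\<And>l j. l \<in> {1..r} \<Longrightarrow> j \<in> {1..<l} \<Longrightarrow> strictly_closer p l j"
    and q: "\<And>i. q i \<in> msupp (p l i)" and q': "\<And>i. q' i \<in> msupp (p j i)"
  shows "weighted_mean lam q \<noteq> weighted_mean lam q'"
proof
  assume eq: "weighted_mean lam q = weighted_mean lam q'"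
  show False
  proof (cases "j < l")
    case True
    then have "strictly_closer p l j" using lj strict by simp
    then have "(norm (weighted_mean lam q - s l))\<^sup>2 < (norm (weighted_mean lam q - s j))\<^sup>2"
      using q by (simp add: strictly_closer_def)
    moreover have "(norm (weighted_mean lam q' - s j))\<^sup>2 \<le> (norm (weighted_mean lam q' - s l))\<^sup>2"
      by (rule mean_closest[OF feas lj(2,1), of q', OF q'])
    ultimately show False unfolding eq by linarith
  next
    case False
    then have "strictly_closer p j l" using lj strict by simp
    then have "(norm (weighted_mean lam q' - s j))\<^sup>2 < (norm (weighted_mean lam q' - s l))\<^sup>2"
      using q' by (simp add: strictly_closer_def)
    moreover have "(norm (weighted_mean lam q - s l))\<^sup>2 \<le> (norm (weighted_mean lam q - s j))\<^sup>2"
      by (rule mean_closest[OF feas lj(1,2), of q, OF q])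
    ultimately show False unfolding eq by linarith
  qed
qed

text \<open>
  The invariant of step 3 for one of the points \<open>s k\<close>: \<open>p0\<close> are its partial measures at the end of
  step 2, \<open>p\<close> the remaining ones, \<open>b\<close> the partial measure created so far. \<open>Q c\<close> is the tuple whose
  weighted mean is \<open>c\<close>; the remaining points lie lexicographically below all these tuples, hence the
  next mean is new.
\<close>

definition decomposed ::
  "('n \<Rightarrow> 'd point \<Rightarrow> real) \<Rightarrow> ('n \<Rightarrow> 'd point \<Rightarrow> real) \<Rightarrow> real \<Rightarrow> ('d point \<Rightarrow> real) \<Rightarrow>
   ('d point \<Rightarrow> 'n \<Rightarrow> 'd point) \<Rightarrow> bool"
where
  "decomposed p0 p d b Q \<longleftrightarrow>
     finite (msupp b) \<and> (\<forall>x. 0 \<le> b x) \<and>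
     (\<forall>c\<in>msupp b. weighted_mean lam (Q c) = c \<and> (\<forall>i. Q c i \<in> msupp (p0 i)) \<and>
        (\<exists>i. Q c i \<notin> msupp (p i)) \<and> (\<forall>i. \<forall>x\<in>msupp (p i). x = Q c i \<or> lex_less x (Q c i))) \<and>
     (\<forall>i w. p0 i w = p i w + (\<Sum>c\<in>msupp b. if Q c i = w then b c else 0)) \<and>
     (\<forall>i x. 0 \<le> p i x) \<and> (\<forall>i. msupp (p0 i) \<subseteq> set_pmf (P i)) \<and> (\<forall>i. msupp (p i) \<subseteq> msupp (p0 i)) \<and>
     (\<forall>i. (\<Sum>x\<in>set_pmf (P i). p i x) = d) \<and>
     (0 < d \<longrightarrow> card (msupp b) + (\<Sum>i\<in>UNIV. card (msupp (p i))) \<le> (\<Sum>i\<in>UNIV. card (set_pmf (P i)))) \<and>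
     card (msupp b) + CARD('n) \<le> (\<Sum>i\<in>UNIV. card (set_pmf (P i))) + 1"

section \<open>Splitting the mass of one point into tuples\<close>

lemma card_univ_le_sum_card: "CARD('n) \<le> (\<Sum>i\<in>(UNIV::'n set). card (set_pmf (P i)))"
proof -
  have "1 \<le> card (set_pmf (P i))" for i
    using finite_P[of i] set_pmf_not_empty[of "P i"] by (simp add: Suc_le_eq card_gt_0_iff)
  then have "(\<Sum>i\<in>(UNIV::'n set). 1) \<le> (\<Sum>i\<in>(UNIV::'n set). card (set_pmf (P i)))"
    by (intro sum_mono) auto
  then show ?thesis by simp
qed

lemma decomposed_initial:
  assumes feas: "feasible d p" "k \<in> {1..r}"
  shows "decomposed (p k) (p k) (d k) (\<lambda>_. 0) Q"
proof -
  have "card (msupp (p k i)) \<le> card (set_pmf (P i))" for i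
    using msupp_feasible[OF feas] finite_P by (simp add: card_mono)
  then have "(\<Sum>i\<in>UNIV. card (msupp (p k i))) \<le> (\<Sum>i\<in>UNIV. card (set_pmf (P i)))"
    by (rule sum_mono)
  moreover have "msupp (\<lambda>_ :: 'd point. 0) = {}" by (auto simp: msupp_def)
  moreover have "\<forall>i x. 0 \<le> p k i x" "\<forall>i. (\<Sum>x\<in>set_pmf (P i). p k i x) = d k"
    using feas unfolding feasible_masses_def by blast+
  ultimately show ?thesis
    unfolding decomposed_def
    using msupp_feasible[OF feas] card_univ_le_sum_card by simp
qed

text \<open>For the count: each step exhausts at least one support point, so tuples plus remaining
  points never exceed the sum of the |P_i|. Before the step each of the N measures still has a
  point, so the tuples present then number at most that sum minus N; the new tuple accounts for the
  final + 1.\<close>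

lemma decomposed_step:
  assumes dec: "decomposed p0 p d b Q" and d: "0 < d"
    and q: "\<And>i. lex_max (msupp (p i)) (q i)"
    and c: "c = weighted_mean lam q" and t: "t = d_min p q"
  shows "decomposed p0 (add_mass p q (- t)) (d - t) (b(c := b c + t)) (Q(c := q))"
proof -
  note D = dec[unfolded decomposed_def]
  have qp: "q i \<in> msupp (p i)" for i using q by (simp add: lex_max_def)
  have t_pos: "0 < t" unfolding t by (rule d_min_pos[of q p, OF qp])
  have qP: "q i \<in> set_pmf (P i)" for i using qp D by blast
  have finp: "finite (msupp (p i))" for i
    using D finite_P by (meson finite_subset)
  let ?p = "add_mass p q (- t)"
  have sub: "msupp (?p i) \<subseteq> msupp (p i)" for i
    unfolding t by (rule msupp_remove_mass_subset[of q p, OF qp])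
  \<comment> \<open>An earlier tuple with mean \<open>c\<close> would dominate \<open>q\<close> for
    every \<open>i\<close> and differ from it, since one of its points is exhausted. Its mean would
    then be strictly larger than that of \<open>q\<close>.\<close>
  have new: "c \<notin> msupp b"
  proof
    assume cb: "c \<in> msupp b"
    then have "q i = Q c i \<or> lex_less (q i) (Q c i)" for i using D qp by blast
    moreover have "\<exists>i. q i \<noteq> Q c i" using D qp cb by metis
    ultimately have "lex_less (weighted_mean lam q) (weighted_mean lam (Q c))"
      by (rule lex_less_weighted_mean[OF lam_pos])
    then show False using D cb c lex_less_irrefl by metis
  qed
  moreover have "0 \<le> b c" using D by blast
  ultimately have bc: "b c = 0" by (simp add: msupp_def)
  let ?b = "b(c := b c + t)"
  have msupp_b: "msupp ?b = insert c (msupp b)"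
    using t_pos bc by (auto simp: msupp_def)
  have finb: "finite (msupp b)" using D by blast
  have "CARD('n) \<le> (\<Sum>i\<in>UNIV. card (msupp (p i)))"
  proof -
    have "1 \<le> card (msupp (p i))" for i
      using finp[of i] qp[of i] by (auto simp: Suc_le_eq card_gt_0_iff)
    then have "(\<Sum>i\<in>(UNIV::'n set). 1) \<le> (\<Sum>i\<in>UNIV. card (msupp (p i)))"
      by (intro sum_mono) auto
    then show ?thesis by simp
  qed
  moreover have "(\<Sum>i\<in>UNIV. card (msupp (?p i))) < (\<Sum>i\<in>UNIV. card (msupp (p i)))"
    unfolding t by (rule sum_card_msupp_remove_mass[of p q, OF finp qp])
  moreover have "card (msupp ?b) = card (msupp b) + 1"
    using new finb by (simp add: msupp_b)
  moreover have "card (msupp b) + (\<Sum>i\<in>UNIV. card (msupp (p i))) \<le> (\<Sum>i\<in>UNIV. card (set_pmf (P i)))"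
    using D d by blast
  ultimately have cards: "card (msupp ?b) + (\<Sum>i\<in>UNIV. card (msupp (?p i))) \<le> (\<Sum>i\<in>UNIV. card (set_pmf (P i)))"
      "card (msupp ?b) + CARD('n) \<le> (\<Sum>i\<in>UNIV. card (set_pmf (P i))) + 1"
    by linarith+
  show ?thesis
    unfolding decomposed_def
  proof (intro conjI allI impI ballI)
    show "finite (msupp ?b)" using finb by (simp add: msupp_b)
    show "0 \<le> ?b x" for x using D t_pos by (simp add: bc)
    show "0 \<le> ?p i x" for i x using D unfolding t by (intro remove_mass_nonneg) blast
    show "msupp (p0 i) \<subseteq> set_pmf (P i)" for i using D by blast
    show "msupp (?p i) \<subseteq> msupp (p0 i)" for i using D sub by blast
    show "(\<Sum>x\<in>set_pmf (P i). ?p i x) = d - t" for i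
      using D by (simp add: sum_add_mass[where q = q, OF finite_P qP])
    show "card (msupp ?b) + (\<Sum>i\<in>UNIV. card (msupp (?p i))) \<le> (\<Sum>i\<in>UNIV. card (set_pmf (P i)))"
      "card (msupp ?b) + CARD('n) \<le> (\<Sum>i\<in>UNIV. card (set_pmf (P i))) + 1"
      by (fact cards)+
  next
    fix i w
    have "(\<Sum>a\<in>msupp ?b. if (Q(c := q)) a i = w then ?b a else 0) =
        (if q i = w then t else 0) + (\<Sum>a\<in>msupp b. if (Q(c := q)) a i = w then ?b a else 0)"
      unfolding msupp_b using new finb bc by simp
    also have "(\<Sum>a\<in>msupp b. if (Q(c := q)) a i = w then ?b a else 0) = (\<Sum>a\<in>msupp b. if Q a i = w then b a else 0)"
      using new by (intro sum.cong) auto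
    finally have new_sum: "(\<Sum>a\<in>msupp ?b. if (Q(c := q)) a i = w then ?b a else 0) =
        (if q i = w then t else 0) + (\<Sum>a\<in>msupp b. if Q a i = w then b a else 0)" .
    have p0: "p0 i w = p i w + (\<Sum>a\<in>msupp b. if Q a i = w then b a else 0)"
      using D by blast
    show "p0 i w = ?p i w + (\<Sum>a\<in>msupp ?b. if (Q(c := q)) a i = w then ?b a else 0)"
      unfolding p0 new_sum by (auto simp: add_mass_def)
  next
    fix a assume a: "a \<in> msupp ?b"
    have old: "weighted_mean lam (Q a) = a" "\<forall>i. Q a i \<in> msupp (p0 i)" "\<exists>i. Q a i \<notin> msupp (p i)"
        "\<forall>i. \<forall>x\<in>msupp (p i). x = Q a i \<or> lex_less x (Q a i)" if "a \<noteq> c"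
    proof -
      have "a \<in> msupp b" using a that by (simp add: msupp_b)
      then show "weighted_mean lam (Q a) = a" "\<forall>i. Q a i \<in> msupp (p0 i)" "\<exists>i. Q a i \<notin> msupp (p i)"
        "\<forall>i. \<forall>x\<in>msupp (p i). x = Q a i \<or> lex_less x (Q a i)"
        using D by blast+
    qed
    show "weighted_mean lam ((Q(c := q)) a) = a" using old(1) c by (cases "a = c") simp_all
    show "(Q(c := q)) a i \<in> msupp (p0 i)" for i
    proof (cases "a = c")
      case True
      have "q i \<in> msupp (p0 i)" using D qp by blast
      then show ?thesis using True by simp
    qed (use old(2) in simp)
    show "\<exists>i. (Q(c := q)) a i \<notin> msupp (?p i)"
    proof (cases "a = c")
      case True
      then show ?thesis using msupp_remove_mass_removes[of q p] by (simp add: t)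
    next
      case False
      then show ?thesis using old(3) sub by auto
    qed
    show "x = (Q(c := q)) a i \<or> lex_less x ((Q(c := q)) a i)" if "x \<in> msupp (?p i)" for i x
    proof -
      have x: "x \<in> msupp (p i)" using that sub by blast
      show ?thesis
      proof (cases "a = c")
        case True
        then show ?thesis using q[of i] x by (auto simp: lex_max_def)
      next
        case False
        then show ?thesis using old(4) x by simp
      qed
    qed
  qed
qed

lemma sum_msupp: "feasible d p \<Longrightarrow> k \<in> {1..r} \<Longrightarrow> (\<Sum>x\<in>set_pmf (P i). p k i x) = d k"
  by (auto simp: feasible_masses_def)

text \<open>With mass 0 left, the tuples account for all of \<open>p0\<close>. The function
  \<open>h\<close> is taken constant for the total mass, an indicator for the column sums and a
  squared distance for the cost.\<close>

lemma sum_over_tuples: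
  fixes h :: "'d point \<Rightarrow> real"
  assumes dec: "decomposed p0 p 0 b Q"
  shows "(\<Sum>w\<in>set_pmf (P i). h w * p0 i w) = (\<Sum>c\<in>msupp b. h (Q c i) * b c)"
proof -
  note D = dec[unfolded decomposed_def]
  have p: "p i w = 0" if "w \<in> set_pmf (P i)" for w
  proof -
    have "(\<Sum>x\<in>set_pmf (P i). p i x) = 0" "\<forall>x. 0 \<le> p i x" using D by blast+
    then show ?thesis using that finite_P[of i] by (simp add: sum_nonneg_eq_0_iff)
  qed
  have p0: "p0 i w = p i w + (\<Sum>c\<in>msupp b. if Q c i = w then b c else 0)" for w
    using D by blast
  have fin: "finite (msupp b)" using D by blast
  have QP: "Q c i \<in> set_pmf (P i)" if "c \<in> msupp b" for c using D that by blast
  have "(\<Sum>w\<in>set_pmf (P i). h w * p0 i w) =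
      (\<Sum>w\<in>set_pmf (P i). \<Sum>c\<in>msupp b. if w = Q c i then h (Q c i) * b c else 0)"
    unfolding p0 by (intro sum.cong refl) (auto simp: p sum_distrib_left intro!: sum.cong)
  also have "\<dots> = (\<Sum>c\<in>msupp b. \<Sum>w\<in>set_pmf (P i). if w = Q c i then h (Q c i) * b c else 0)"
    by (rule sum.swap)
  also have "\<dots> = (\<Sum>c\<in>msupp b. h (Q c i) * b c)"
    using finite_P QP by (intro sum.cong) simp_all
  finally show ?thesis .
qed

primrec invariant :: "('n, 'd point) config \<Rightarrow> bool" where
  "invariant (Merging l j d p) \<longleftrightarrow>
     feasible d p \<and> cost p = C \<and> l \<le> r \<and> 1 \<le> j \<and>
     (\<forall>l' j'. l < l' \<and> l' \<le> r \<and> 1 \<le> j' \<and> j' < l' \<longrightarrow> strictly_closer p l' j') \<and>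
     (\<forall>j'. 1 \<le> j' \<and> j' < j \<and> j' < l \<longrightarrow> strictly_closer p l j')"
| "invariant (Splitting l d p B) \<longleftrightarrow>
     1 \<le> l \<and> (\<forall>k. 1 \<le> k \<and> k < l \<and> k \<le> r \<longrightarrow> d k = 0) \<and>
     (\<exists>d0 p0 Q. feasible d0 p0 \<and> cost p0 = C \<and>
        (\<forall>l j. l \<le> r \<and> 1 \<le> j \<and> j < l \<longrightarrow> strictly_closer p0 l j) \<and>
        (\<forall>k. 1 \<le> k \<and> k \<le> r \<longrightarrow> decomposed (p0 k) (p k) (d k) (B k) (Q k)))"
| "invariant (Returned m) \<longleftrightarrow>
     (\<exists>P'. m = pmf P' \<and> finite (set_pmf P') \<and> set_pmf P' \<subseteq> S_centers P lam \<and>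
        (\<exists>y'. transport P' P y' \<and> non_mass_splitting P' P y' \<and>
           transport_cost (set_pmf P') P lam y' \<le> C) \<and>
        int (card (set_pmf P')) \<le> int r * ((\<Sum>i\<in>UNIV. int (card (set_pmf (P i)))) - int CARD('n) + 1))"

text \<open>Every returned point determines the position it was split from and its tuple there,
  since means of different positions differ. Sending its whole mass along that tuple gives the
  transport.\<close>

lemma invariant_returned:
  assumes feas: "feasible d0 p0" "cost p0 = C"
    and strict: "\<And>l j. l \<in> {1..r} \<Longrightarrow> j \<in> {1..<l} \<Longrightarrow> strictly_closer p0 l j"
    and dec: "\<And>k. k \<in> {1..r} \<Longrightarrow> decomposed (p0 k) (p k) 0 (B k) (Q k)"
  shows "invariant (Returned (\<lambda>x. \<Sum>k=1..r. B k x))"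
proof -
  define m where "m x = (\<Sum>k=1..r. B k x)" for x
  define X where "X = (\<Union>k\<in>{1..r}. msupp (B k))"
  have fin: "finite (msupp (B k))" and B_nonneg: "\<forall>x. 0 \<le> B k x"
    and Q_mean: "\<forall>c\<in>msupp (B k). weighted_mean lam (Q k c) = c"
    and Q_supp: "\<forall>c\<in>msupp (B k). \<forall>i. Q k c i \<in> msupp (p0 k i)"
    and card_B: "card (msupp (B k)) + CARD('n) \<le> (\<Sum>i\<in>UNIV. card (set_pmf (P i))) + 1"
    if "k \<in> {1..r}" for k
    using dec[OF that] unfolding decomposed_def by blast+
  have B_0: "B k x = 0" if "k \<in> {1..r}" "x \<notin> msupp (B k)" for k x
  proof -
    have "0 \<le> B k x" using B_nonneg that by blast
    then show ?thesis using that by (simp add: msupp_def)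
  qed
  have finX: "finite X" using fin by (simp add: X_def)
  have disj: "msupp (B k) \<inter> msupp (B k') = {}" if k: "k \<in> {1..r}" "k' \<in> {1..r}" "k \<noteq> k'" for k k'
  proof (rule ccontr)
    assume "msupp (B k) \<inter> msupp (B k') \<noteq> {}"
    then obtain c where c: "c \<in> msupp (B k)" "c \<in> msupp (B k')" by blast
    have "weighted_mean lam (Q k c) \<noteq> weighted_mean lam (Q k' c)"
      using means_differ[OF feas k strict] Q_supp c k by blast
    then show False using Q_mean c k by metis
  qed
  have sumX: "(\<Sum>c\<in>X. F c) = (\<Sum>k=1..r. \<Sum>c\<in>msupp (B k). F c)" for F :: "'d point \<Rightarrow> real"
    unfolding X_def using fin disj by (intro sum.UNION_disjoint) auto
  have m_eq: "m c = B k c" if k: "k \<in> {1..r}" and c: "c \<in> msupp (B k)" for k c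
  proof -
    have "(\<Sum>k'=1..r. B k' c) = (\<Sum>k'\<in>{k}. B k' c)"
    proof (rule sum.mono_neutral_right)
      show "\<forall>k'\<in>{1..r} - {k}. B k' c = 0"
      proof
        fix k' assume k': "k' \<in> {1..r} - {k}"
        then have "c \<notin> msupp (B k')" using disj[of k k'] k c by blast
        then show "B k' c = 0" using B_0 k' by blast
      qed
    qed (use k in auto)
    then show ?thesis by (simp add: m_def)
  qed
  have m_nonneg: "0 \<le> m x" for x
    unfolding m_def using B_nonneg by (intro sum_nonneg) blast
  have m_0: "m x = 0" if "x \<notin> X" for x
    unfolding m_def using that B_0 by (intro sum.neutral) (auto simp: X_def)
  have m_pos: "0 < m x" if x: "x \<in> X" for x
  proof -
    obtain k where k: "k \<in> {1..r}" "x \<in> msupp (B k)" using x by (auto simp: X_def)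
    then show ?thesis using m_eq[OF k] by (simp add: msupp_def)
  qed
  have m_sum: "(\<Sum>x\<in>X. m x) = 1"
  proof -
    \<comment> \<open>An arbitrary index: the total mass is computed through the transport to
      \<open>P i\<close>.\<close>
    fix i :: 'n
    have "(\<Sum>x\<in>X. m x) = (\<Sum>k=1..r. \<Sum>c\<in>msupp (B k). B k c)"
      unfolding sumX by (intro sum.cong refl m_eq)
    also have "\<dots> = (\<Sum>k=1..r. \<Sum>w\<in>set_pmf (P i). p0 k i w)"
    proof (rule sum.cong[OF refl])
      fix k assume "k \<in> {1..r}"
      then show "(\<Sum>c\<in>msupp (B k). B k c) = (\<Sum>w\<in>set_pmf (P i). p0 k i w)"
        using sum_over_tuples[OF dec, of k "\<lambda>_. 1" i] by simp
    qed
    also have "\<dots> = (\<Sum>w\<in>set_pmf (P i). \<Sum>k=1..r. p0 k i w)" by (rule sum.swap)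
    also have "\<dots> = (\<Sum>w\<in>set_pmf (P i). pmf (P i) w)"
      using feas(1) unfolding feasible_masses_def by (intro sum.cong) blast+
    also have "\<dots> = 1" using finite_P by (intro sum_pmf_eq_1) auto
    finally show ?thesis .
  qed
  obtain P' where P': "pmf P' = m"
    using pmf_of_mass_function[OF finX m_nonneg m_0 m_sum] by blast
  have set_P': "set_pmf P' = X"
    using m_0 m_pos by (fastforce simp: set_pmf_eq P')
  \<comment> \<open>The position from which \<open>c\<close> was split; it is unique because the
    supports of the \<open>B k\<close> are disjoint.\<close>
  define \<kappa> where "\<kappa> c = (SOME k. k \<in> {1..r} \<and> c \<in> msupp (B k))" for c
  have \<kappa>: "\<kappa> c \<in> {1..r}" "c \<in> msupp (B (\<kappa> c))" if "c \<in> X" for c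
    using that someI_ex[of "\<lambda>k. k \<in> {1..r} \<and> c \<in> msupp (B k)"] unfolding \<kappa>_def X_def by blast+
  have \<kappa>_eq: "\<kappa> c = k" if "k \<in> {1..r}" "c \<in> msupp (B k)" for k c
  proof -
    have "c \<in> X" using that by (auto simp: X_def)
    then show ?thesis using \<kappa>[of c] disj[of "\<kappa> c" k] that by blast
  qed
  define q where "q c = Q (\<kappa> c) c" for c
  have q_P: "q c i \<in> set_pmf (P i)" if "c \<in> X" for c i
    using \<kappa>[OF that] Q_supp msupp_feasible(1)[OF feas(1)] unfolding q_def by blast
  have q_mean: "weighted_mean lam (q c) = c" if "c \<in> X" for c
    using \<kappa>[OF that] Q_mean unfolding q_def by blast
  define y' where "y' i c w = (if w = q c i then m c else 0)" for i c w
  have sum_y': "(\<Sum>w\<in>set_pmf (P i). h w * y' i c w) = h (q c i) * m c" if "c \<in> X" for h i c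
    unfolding y'_def using q_P[OF that] finite_P by (simp add: if_distrib[of "(*) _"] cong: if_cong)
  have transport: "transport P' P y'"
    unfolding transport_def set_P' P'
  proof (intro conjI allI ballI)
    show "0 \<le> y' i x w" for i x w using m_nonneg by (simp add: y'_def)
    show "(\<Sum>w\<in>set_pmf (P i). y' i x w) = m x" if "x \<in> X" for i x
      using sum_y'[OF that, where h = "\<lambda>_. 1" and i = i] by simp
  next
    fix i w assume w: "w \<in> set_pmf (P i)"
    have "(\<Sum>x\<in>X. y' i x w) = (\<Sum>k=1..r. \<Sum>c\<in>msupp (B k). (if Q k c i = w then 1 else 0) * B k c)"
      unfolding sumX by (intro sum.cong refl) (auto simp: y'_def q_def \<kappa>_eq m_eq)
    also have "\<dots> = (\<Sum>k=1..r. \<Sum>v\<in>set_pmf (P i). (if v = w then 1 else 0) * p0 k i v)"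
    proof (rule sum.cong[OF refl])
      fix k assume "k \<in> {1..r}"
      then show "(\<Sum>c\<in>msupp (B k). (if Q k c i = w then 1 else 0) * B k c) =
          (\<Sum>v\<in>set_pmf (P i). (if v = w then 1 else 0) * p0 k i v)"
        using sum_over_tuples[OF dec, of k "\<lambda>v. if v = w then 1 else 0" i] by simp
    qed
    also have "\<dots> = (\<Sum>k=1..r. p0 k i w)"
      using w finite_P by (simp add: if_distrib[of "\<lambda>x. x * _"] cong: if_cong)
    also have "\<dots> = pmf (P i) w"
      using feas(1) w unfolding feasible_masses_def by blast
    finally show "(\<Sum>x\<in>X. y' i x w) = pmf (P i) w" .
  qed
  have splitting: "non_mass_splitting P' P y'"
    unfolding non_mass_splitting_def set_P' P'
  proof (intro ballI allI ex_ex1I conjI impI)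
    fix x i assume x: "x \<in> X"
    show "\<exists>w. w \<in> set_pmf (P i) \<and> y' i x w = m x \<and> (\<forall>w'\<in>set_pmf (P i). w' \<noteq> w \<longrightarrow> y' i x w' = 0)"
      using q_P[OF x] by (intro exI[of _ "q x i"]) (simp add: y'_def)
    fix w w'
    assume "w \<in> set_pmf (P i) \<and> y' i x w = m x \<and> (\<forall>w'\<in>set_pmf (P i). w' \<noteq> w \<longrightarrow> y' i x w' = 0)"
      "w' \<in> set_pmf (P i) \<and> y' i x w' = m x \<and> (\<forall>w''\<in>set_pmf (P i). w'' \<noteq> w' \<longrightarrow> y' i x w'' = 0)"
    then have "y' i x w = m x" "y' i x w' = m x" by auto
    then show "w = w'" using m_pos[OF x] by (simp add: y'_def split: if_splits)
  qed
  have cost: "transport_cost X P lam y' \<le> C"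
  proof -
    have "transport_cost X P lam y' = (\<Sum>i\<in>UNIV. lam i * (\<Sum>x\<in>X. (norm (x - q x i))\<^sup>2 * m x))"
      unfolding transport_cost_def by (simp add: sum_y')
    also have "\<dots> = (\<Sum>i\<in>UNIV. \<Sum>x\<in>X. m x * (lam i * (norm (x - q x i))\<^sup>2))"
      by (simp add: sum_distrib_left mult_ac)
    also have "\<dots> = (\<Sum>x\<in>X. m x * (\<Sum>i\<in>UNIV. lam i * (norm (x - q x i))\<^sup>2))"
      by (subst sum.swap) (simp only: sum_distrib_left)
    \<comment> \<open>The mean minimizes the weighted squared distance to its tuple, so replacing it
      by the original point \<open>s (\<kappa> x)\<close> can only cost more. What results is the
      cost before splitting.\<close>
    also have "\<dots> \<le> (\<Sum>x\<in>X. m x * (\<Sum>i\<in>UNIV. lam i * (norm (s (\<kappa> x) - q x i))\<^sup>2))"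
    proof (rule sum_mono)
      fix x assume "x \<in> X"
      then have "(\<Sum>i\<in>UNIV. lam i * (norm (x - q x i))\<^sup>2) \<le> (\<Sum>i\<in>UNIV. lam i * (norm (s (\<kappa> x) - q x i))\<^sup>2)"
        using sum_weighted_dist_decomposition[OF lam_sum, of "s (\<kappa> x)" "q x"] q_mean[of x] by simp
      then show "m x * (\<Sum>i\<in>UNIV. lam i * (norm (x - q x i))\<^sup>2) \<le>
          m x * (\<Sum>i\<in>UNIV. lam i * (norm (s (\<kappa> x) - q x i))\<^sup>2)"
        using m_nonneg by (rule mult_left_mono)
    qed
    also have "\<dots> = (\<Sum>i\<in>UNIV. \<Sum>x\<in>X. m x * (lam i * (norm (s (\<kappa> x) - q x i))\<^sup>2))"
      by (subst sum.swap) (simp only: sum_distrib_left)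
    also have "\<dots> = (\<Sum>i\<in>UNIV. lam i * (\<Sum>x\<in>X. (norm (s (\<kappa> x) - q x i))\<^sup>2 * m x))"
      by (simp add: sum_distrib_left mult_ac)
    also have "\<dots> = cost p0"
      unfolding masses_cost_def
    proof (intro sum.cong refl arg_cong2[where f = "(*)"])
      fix i
      have "(\<Sum>x\<in>X. (norm (s (\<kappa> x) - q x i))\<^sup>2 * m x) =
          (\<Sum>k=1..r. \<Sum>c\<in>msupp (B k). (norm (s k - Q k c i))\<^sup>2 * B k c)"
        unfolding sumX by (intro sum.cong refl) (simp add: q_def \<kappa>_eq m_eq)
      also have "\<dots> = (\<Sum>k=1..r. \<Sum>w\<in>set_pmf (P i). (norm (s k - w))\<^sup>2 * p0 k i w)"
      proof (rule sum.cong[OF refl])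
        fix k assume "k \<in> {1..r}"
        then show "(\<Sum>c\<in>msupp (B k). (norm (s k - Q k c i))\<^sup>2 * B k c) =
            (\<Sum>w\<in>set_pmf (P i). (norm (s k - w))\<^sup>2 * p0 k i w)"
          using sum_over_tuples[OF dec, of k "\<lambda>w. (norm (s k - w))\<^sup>2" i] by simp
      qed
      finally show "(\<Sum>x\<in>X. (norm (s (\<kappa> x) - q x i))\<^sup>2 * m x) =
          (\<Sum>k=1..r. \<Sum>w\<in>set_pmf (P i). (norm (s k - w))\<^sup>2 * p0 k i w)" .
    qed
    finally show ?thesis using feas(2) by simp
  qed
  have centers: "X \<subseteq> S_centers P lam"
  proof
    fix c assume c: "c \<in> X"
    then have "c = weighted_mean lam (q c)" "\<forall>i. q c i \<in> set_pmf (P i)"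
      using q_mean q_P by auto
    then show "c \<in> S_centers P lam"
      unfolding S_centers_def by blast
  qed
  have card: "int (card X) \<le> int r * ((\<Sum>i\<in>UNIV. int (card (set_pmf (P i)))) - int CARD('n) + 1)"
  proof -
    have "int (card X) \<le> int (\<Sum>k=1..r. card (msupp (B k)))"
      unfolding X_def by (intro of_nat_mono card_UN_le) simp
    also have "\<dots> = (\<Sum>k=1..r. int (card (msupp (B k))))" by simp
    also have "\<dots> \<le> (\<Sum>k=1..r. (\<Sum>i\<in>UNIV. int (card (set_pmf (P i)))) - int CARD('n) + 1)"
    proof (rule sum_mono)
      fix k assume "k \<in> {1..r}"
      from card_B[OF this]
      have "int (card (msupp (B k)) + CARD('n)) \<le> int ((\<Sum>i\<in>UNIV. card (set_pmf (P i))) + 1)"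
        by (rule of_nat_mono)
      then show "int (card (msupp (B k))) \<le> (\<Sum>i\<in>UNIV. int (card (set_pmf (P i)))) - int CARD('n) + 1"
        by simp
    qed
    finally show ?thesis by simp
  qed
  have "m = pmf P'" by (simp add: P')
  then show ?thesis
    unfolding invariant.simps m_def[symmetric]
    using finX centers transport splitting cost card set_P' by (intro exI[of _ P'] conjI exI[of _ y']) auto
qed

section \<open>Runs of the algorithm: preservation, termination, stuck configurations\<close>

lemma msupp_empty_if_no_mass:
  assumes "feasible d p" "k \<in> {1..r}" "\<not> 0 < d k"
  shows "msupp (p k i) = {}"
proof -
  have nonneg: "\<forall>x. 0 \<le> p k i x" and sum: "(\<Sum>x\<in>set_pmf (P i). p k i x) = d k"
    and outside: "\<forall>x. x \<notin> set_pmf (P i) \<longrightarrow> p k i x = 0"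
    using assms(1,2) unfolding feasible_masses_def by blast+
  have "0 \<le> (\<Sum>x\<in>set_pmf (P i). p k i x)"
    using nonneg by (intro sum_nonneg) blast
  then have "(\<Sum>x\<in>set_pmf (P i). p k i x) = 0"
    using assms(3) unfolding sum by linarith
  then have "\<forall>x\<in>set_pmf (P i). p k i x = 0"
    using nonneg finite_P[of i] by (subst (asm) sum_nonneg_eq_0_iff) auto
  then have "p k i x = 0" for x using outside by blast
  then show ?thesis by (simp add: msupp_def)
qed

lemma algorithm2_step_invariant:
  assumes "algorithm2_step lam s r c c'" "invariant c"
  shows "invariant c'"
  using assms
proof cases
  case (merge l j d p q m t)
  have inv: "feasible d p" "cost p = C" "l \<le> r" "1 \<le> j"
    "\<forall>l' j'. l < l' \<and> l' \<le> r \<and> 1 \<le> j' \<and> j' < l' \<longrightarrow> strictly_closer p l' j'"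
    "\<forall>j'. 1 \<le> j' \<and> j' < j \<and> j' < l \<longrightarrow> strictly_closer p l j'"
    using assms(2) unfolding merge(1) invariant.simps by blast+
  have lj: "l \<in> {1..r}" "j \<in> {1..r}" "l \<noteq> j" using merge inv by auto
  have q: "q i \<in> msupp (p l i)" for i using merge(6)[of i] by (simp add: is_arg_max_def)
  have qP: "q i \<in> set_pmf (P i)" for i using q msupp_feasible(1)[OF inv(1) lj(1)] by blast
  define p' where "p' = moved l j q t p"
  have feas: "feasible (d(l := d l - t, j := d j + t)) p'"
    unfolding p'_def merge(9) by (rule feasible_moved[OF inv(1) lj, of q, OF q])
  \<comment> \<open>The test passed by this merge makes the change of cost vanish.\<close>
  have cost: "cost p' = C"
    unfolding p'_def using cost_moved[OF lj, of q t p, OF qP] merge(7,8) inv(2) by simp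
  \<comment> \<open>Only the measures at \<open>l\<close> and at the smaller \<open>j\<close>
    change, so everything known about larger indices survives; at \<open>l\<close> itself supports
    shrink, which preserves strictness too.\<close>
  have other: "p' l' = p l'" if "l < l'" for l'
    using that \<open>j < l\<close> by (simp add: p'_def moved_def)
  have same: "msupp (p' l i) \<subseteq> msupp (p l i)" for i
    using msupp_remove_mass_subset[of q "p l" i, OF q] lj(3) by (simp add: p'_def moved_def merge(9))
  have "invariant (Merging l j (d(l := d l - t, j := d j + t)) p')"
    unfolding invariant.simps
  proof (intro conjI allI impI; (elim conjE)?)
    fix l' j' assume "l < l'" "l' \<le> r" "1 \<le> j'" "j' < l'"
    then have "strictly_closer p l' j'" using inv(5) by blast
    then show "strictly_closer p' l' j'" using other[OF \<open>l < l'\<close>] by (simp add: strictly_closer_def)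
  next
    fix j' assume "1 \<le> j'" "j' < j" "j' < l"
    then have "strictly_closer p l j'" using inv(6) by blast
    then show "strictly_closer p' l j'" using same by (rule strictly_closer_mono)
  qed (use feas cost inv(3,4) in auto)
  then show ?thesis unfolding merge(2) p'_def moved_def .
next
  case (merge_skip l j d p q m)
  have inv: "feasible d p" "cost p = C" "l \<le> r" "1 \<le> j"
    "\<forall>l' j'. l < l' \<and> l' \<le> r \<and> 1 \<le> j' \<and> j' < l' \<longrightarrow> strictly_closer p l' j'"
    "\<forall>j'. 1 \<le> j' \<and> j' < j \<and> j' < l \<longrightarrow> strictly_closer p l j'"
    using assms(2) unfolding merge_skip(1) invariant.simps by blast+
  have "l \<in> {1..r}" "j \<in> {1..r}" using merge_skip inv by auto
  then have "strictly_closer p l j"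
    using merge_skip by (intro strictly_closer_if_argmax[OF inv(1,2)]) auto
  then have "\<forall>j'. 1 \<le> j' \<and> j' < j + 1 \<and> j' < l \<longrightarrow> strictly_closer p l j'"
    using inv(6) by (metis Suc_eq_plus1 less_Suc_eq)
  then show ?thesis
    unfolding merge_skip(2) invariant.simps using inv(1-5) by auto
next
  case (merge_next l j d p)
  have inv: "feasible d p" "cost p = C" "l \<le> r" "1 \<le> j"
    "\<forall>l' j'. l < l' \<and> l' \<le> r \<and> 1 \<le> j' \<and> j' < l' \<longrightarrow> strictly_closer p l' j'"
    "\<forall>j'. 1 \<le> j' \<and> j' < j \<and> j' < l \<longrightarrow> strictly_closer p l j'"
    using assms(2) unfolding merge_next(1) invariant.simps by blast+
  \<comment> \<open>The loop over \<open>j\<close> ends either because \<open>j\<close> has reached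
    \<open>l\<close>, with all smaller indices treated, or because \<open>d l\<close> is used up and
    no tuple is left.\<close>
  have now: "strictly_closer p l j'" if j': "1 \<le> j'" "j' < l" for j'
  proof (cases "j < l")
    case True
    then have "msupp (p l i) = {}" for i
      using merge_next inv by (intro msupp_empty_if_no_mass[OF inv(1)]) auto
    then show ?thesis by (simp add: strictly_closer_def)
  next
    case False
    then show ?thesis using inv(6) j' by auto
  qed
  have "strictly_closer p l' j'" if "l - 1 < l'" "l' \<le> r" "1 \<le> j'" "j' < l'" for l' j'
  proof (cases "l' = l")
    case False
    then have "l < l'" using that(1) by simp
    then show ?thesis using inv(5) that by blast
  qed (use now that in simp)
  then show ?thesis
    unfolding merge_next(2) invariant.simps using inv(1-3) by auto
next
  case (merge_done j d p)
  have inv: "feasible d p" "cost p = C"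
    "\<forall>l' j'. 0 < l' \<and> l' \<le> r \<and> 1 \<le> j' \<and> j' < l' \<longrightarrow> strictly_closer p l' j'"
    using assms(2) unfolding merge_done(1) invariant.simps by blast+
  \<comment> \<open>No means have been created yet, so the tuple assignment is arbitrary;
    \<open>undefined\<close> serves as one.\<close>
  have "\<forall>k. 1 \<le> k \<and> k \<le> r \<longrightarrow> decomposed (p k) (p k) (d k) (\<lambda>_. 0) (undefined k)"
    using decomposed_initial[OF inv(1)] by simp
  then have "\<exists>d0 p0 Q. feasible d0 p0 \<and> cost p0 = C \<and>
      (\<forall>l j. l \<le> r \<and> 1 \<le> j \<and> j < l \<longrightarrow> strictly_closer p0 l j) \<and>
      (\<forall>k. 1 \<le> k \<and> k \<le> r \<longrightarrow> decomposed (p0 k) (p k) (d k) (\<lambda>_. 0) (Q k))"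
    using inv by (intro exI[of _ d] exI[of _ p] exI[of _ undefined] conjI) auto
  then show ?thesis
    unfolding merge_done(2) invariant.simps by simp
next
  case (split l d p q m t B)
  obtain d0 p0 Q where inv: "1 \<le> l" "\<forall>k. 1 \<le> k \<and> k < l \<and> k \<le> r \<longrightarrow> d k = 0"
    "feasible d0 p0" "cost p0 = C" "\<forall>l j. l \<le> r \<and> 1 \<le> j \<and> j < l \<longrightarrow> strictly_closer p0 l j"
    "\<forall>k. 1 \<le> k \<and> k \<le> r \<longrightarrow> decomposed (p0 k) (p k) (d k) (B k) (Q k)"
    using assms(2) unfolding split(1) invariant.simps by blast
  define p' where "p' = p(l := add_mass (p l) q (- t))"
  define d' where "d' = d(l := d l - t)"
  define B' where "B' = B(l := (B l)(m := B l m + t))"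
  define Q' where "Q' = Q(l := (Q l)(m := q))"
  have "decomposed (p0 k) (p' k) (d' k) (B' k) (Q' k)" if "1 \<le> k \<and> k \<le> r" for k
  proof (cases "k = l")
    case True
    have "decomposed (p0 l) (p l) (d l) (B l) (Q l)" using inv(1,6) split(3) by blast
    then have "decomposed (p0 l) (add_mass (p l) q (- t)) (d l - t) ((B l)(m := B l m + t)) ((Q l)(m := q))"
      using split by (intro decomposed_step) auto
    then show ?thesis using True by (simp add: p'_def d'_def B'_def Q'_def)
  next
    case False
    then show ?thesis using inv(6) that by (simp add: p'_def d'_def B'_def Q'_def)
  qed
  moreover have "\<forall>k. 1 \<le> k \<and> k < l \<and> k \<le> r \<longrightarrow> d' k = 0"
    using inv(2) by (simp add: d'_def)
  ultimately have "invariant (Splitting l d' p' B')"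
    unfolding invariant.simps using inv(1,3-5) by blast
  then show ?thesis unfolding split(2) p'_def d'_def B'_def .
next
  case (split_next l d p B)
  obtain d0 p0 Q where inv: "1 \<le> l" "\<forall>k. 1 \<le> k \<and> k < l \<and> k \<le> r \<longrightarrow> d k = 0"
    "feasible d0 p0" "cost p0 = C" "\<forall>l j. l \<le> r \<and> 1 \<le> j \<and> j < l \<longrightarrow> strictly_closer p0 l j"
    "\<forall>k. 1 \<le> k \<and> k \<le> r \<longrightarrow> decomposed (p0 k) (p k) (d k) (B k) (Q k)"
    using assms(2) unfolding split_next(1) invariant.simps by blast
  \<comment> \<open>The guard only says that \<open>d l\<close> is not positive; nonnegativity comes
    from its being a sum of masses, for any index \<open>i\<close>.\<close>
  have "d l = 0"
  proof -
    fix i :: 'n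
    have "decomposed (p0 l) (p l) (d l) (B l) (Q l)" using inv(1,6) split_next(3) by blast
    then have "(\<Sum>x\<in>set_pmf (P i). p l i x) = d l" "\<forall>x. 0 \<le> p l i x"
      unfolding decomposed_def by blast+
    then have "0 \<le> d l" by (metis sum_nonneg)
    then show ?thesis using split_next(4) by simp
  qed
  then have "\<forall>k. 1 \<le> k \<and> k < l + 1 \<and> k \<le> r \<longrightarrow> d k = 0"
    using inv(2) by (metis Suc_eq_plus1 less_Suc_eq)
  moreover have "1 \<le> l + 1" by simp
  ultimately show ?thesis
    unfolding split_next(2) invariant.simps using inv(3-6) by blast
next
  case (split_done l d p B)
  obtain d0 p0 Q where inv: "\<forall>k. 1 \<le> k \<and> k < l \<and> k \<le> r \<longrightarrow> d k = 0"
    "feasible d0 p0" "cost p0 = C" "\<forall>l j. l \<le> r \<and> 1 \<le> j \<and> j < l \<longrightarrow> strictly_closer p0 l j"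
    "\<forall>k. 1 \<le> k \<and> k \<le> r \<longrightarrow> decomposed (p0 k) (p k) (d k) (B k) (Q k)"
    using assms(2) unfolding split_done(1) invariant.simps by blast
  have "decomposed (p0 k) (p k) 0 (B k) (Q k)" if "k \<in> {1..r}" for k
  proof -
    have "d k = 0" using inv(1) that split_done(3) by auto
    then show ?thesis using inv(5)[rule_format, of k] that by simp
  qed
  then show ?thesis
    unfolding split_done(2) using inv(4) by (intro invariant_returned[OF inv(2,3)]) auto
qed

text \<open>The components are the phase, the outer index, the remaining range of \<open>j\<close>,
  and the support points left at \<open>l\<close>. The last one looks at \<open>l\<close> only,
  since a merge may enlarge the supports at \<open>j\<close>. In \<open>r + 1 - l\<close> the 1
  makes the value drop also when the last index \<open>l = r\<close> is left.\<close>

primrec progress :: "('n, 'd point) config \<Rightarrow> nat \<times> nat \<times> nat \<times> nat" where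
  "progress (Merging l j d p) = (2, l, l - j, \<Sum>i\<in>UNIV. card (msupp (p l i)))"
| "progress (Splitting l d p B) = (1, r + 1 - l, 0, \<Sum>i\<in>UNIV. card (msupp (p l i)))"
| "progress (Returned m) = (0, 0, 0, 0)"

lemma algorithm2_step_progress:
  assumes "algorithm2_step lam s r c c'" "invariant c"
  shows "(progress c', progress c) \<in> less_than <*lex*> less_than <*lex*> less_than <*lex*> less_than"
  using assms
proof cases
  case (merge l j d p q m t)
  have feas: "feasible d p" "l \<in> {1..r}"
    using assms(2) merge(3) unfolding merge(1) invariant.simps by auto
  have q: "q i \<in> msupp (p l i)" for i using merge(6)[of i] by (simp add: is_arg_max_def)
  have "(\<Sum>i\<in>UNIV. card (msupp (add_mass (p l) q (- t) i))) < (\<Sum>i\<in>UNIV. card (msupp (p l i)))"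
    unfolding merge(9) using sum_card_msupp_remove_mass[of "p l" q, OF msupp_feasible(2)[OF feas] q] .
  then show ?thesis using merge(1,2,4) by simp
next
  case (split l d p q m t B)
  obtain p0 Q where "decomposed (p0 l) (p l) (d l) (B l) (Q l)"
    using assms(2) split(3) unfolding split(1) invariant.simps by blast
  then have "msupp (p l i) \<subseteq> set_pmf (P i)" for i
    unfolding decomposed_def by blast
  then have fin: "finite (msupp (p l i))" for i using finite_P finite_subset by metis
  have q: "q i \<in> msupp (p l i)" for i using split(5)[of i] by (simp add: lex_max_def)
  have "(\<Sum>i\<in>UNIV. card (msupp (add_mass (p l) q (- t) i))) < (\<Sum>i\<in>UNIV. card (msupp (p l i)))"
    unfolding split(7) using sum_card_msupp_remove_mass[of "p l" q, OF fin q] .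
  then show ?thesis using split(1,2) by simp
qed (auto intro: diff_less_mono2)

lemma algorithm2_terminates:
  assumes "invariant c0"
  shows "\<not> (\<exists>run. run 0 = c0 \<and> (\<forall>n. algorithm2_step lam s r (run n) (run (Suc n))))"
proof
  assume "\<exists>run. run 0 = c0 \<and> (\<forall>n. algorithm2_step lam s r (run n) (run (Suc n)))"
  then obtain run where run: "run 0 = c0" "\<And>n. algorithm2_step lam s r (run n) (run (Suc n))"
    by blast
  have inv: "invariant (run n)" for n
    by (induction n) (use assms run algorithm2_step_invariant in auto)
  have "(progress (run (Suc n)), progress (run n)) \<in> less_than <*lex*> less_than <*lex*> less_than <*lex*> less_than" for n
    using algorithm2_step_progress run(2) inv by blast
  moreover have "wf (less_than <*lex*> less_than <*lex*> less_than <*lex*> less_than)"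
    by (intro wf_lex_prod wf_less_than)
  ultimately show False
    unfolding wf_iff_no_infinite_down_chain by (auto dest!: spec[of _ "\<lambda>n. progress (run n)"])
qed

text \<open>As long as \<open>d l\<close> is positive, it is the total of every partial measure at
  \<open>l\<close>, so all supports are finite and nonempty. The maximizers required by the rules
  therefore exist, and the guards cover all cases.\<close>

lemma algorithm2_stuck_returned:
  assumes inv: "invariant c" and stuck: "\<not> (\<exists>c'. algorithm2_step lam s r c c')"
  shows "\<exists>m. c = Returned m"
proof (cases c)
  case (Merging l j d p)
  have False
  proof (cases "1 \<le> l \<and> j < l \<and> 0 < d l")
    case False
    show False
    proof (cases "l = 0")
      case True
      then show False
        using algorithm2_step.merge_done stuck unfolding Merging by blast
    next
      case l: False
      then have "1 \<le> l" "\<not> (j < l \<and> 0 < d l)" using False by auto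
      then show False
        using algorithm2_step.merge_next stuck unfolding Merging by blast
    qed
  next
    case True
    have feas: "feasible d p" "l \<in> {1..r}"
      using inv True unfolding Merging invariant.simps by auto
    have "\<exists>x. is_arg_max (\<lambda>x. (s j - s l) \<bullet> x) (\<lambda>x. x \<in> msupp (p l i)) x" for i
    proof -
      have "finite (msupp (p l i))" by (rule msupp_feasible(2)[OF feas])
      moreover have "msupp (p l i) \<noteq> {}"
        using sum_msupp[OF feas, of i] True by (intro msupp_nonempty_if_sum_pos[where A = "set_pmf (P i)"]) auto
      \<comment> \<open>A maximizer is obtained as a minimizer of the negated function.\<close>
      ultimately obtain x where "is_arg_min (\<lambda>x. - ((s j - s l) \<bullet> x)) (\<lambda>x. x \<in> msupp (p l i)) x"
        using ex_is_arg_min_if_finite by blast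
      then show ?thesis by (auto simp: is_arg_min_def is_arg_max_def)
    qed
    then obtain q where q: "\<And>i. is_arg_max (\<lambda>x. (s j - s l) \<bullet> x) (\<lambda>x. x \<in> msupp (p l i)) (q i)"
      by metis
    have l: "1 \<le> l" "j < l" "0 < d l" using True by auto
    show False
    proof (cases "(norm (weighted_mean lam q - s j))\<^sup>2 = (norm (weighted_mean lam q - s l))\<^sup>2")
      case True
      show False
        using algorithm2_step.merge[where l = l and j = j and d = d and s = s and p = p and q = q and lam = lam, OF l q refl True refl] stuck unfolding Merging by blast
    next
      case False
      show False
        using algorithm2_step.merge_skip[where l = l and j = j and d = d and s = s and p = p and q = q and lam = lam, OF l q refl False] stuck unfolding Merging by blast
    qed
  qed
  then show ?thesis ..
next
  case (Splitting l d p B)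
  have False
  proof (cases "l \<le> r \<and> 0 < d l")
    case False
    show False
    proof (cases "l \<le> r")
      case True
      then have "\<not> 0 < d l" using False by simp
      with True show False
        using algorithm2_step.split_next stuck unfolding Splitting by blast
    next
      case False
      then have "r < l" by simp
      then show False
        using algorithm2_step.split_done stuck unfolding Splitting by blast
    qed
  next
    case True
    obtain p0 Q where "decomposed (p0 l) (p l) (d l) (B l) (Q l)"
      using inv True unfolding Splitting invariant.simps by blast
    then have sub: "\<forall>i. msupp (p l i) \<subseteq> set_pmf (P i)"
      and sum: "\<forall>i. (\<Sum>x\<in>set_pmf (P i). p l i x) = d l"
      unfolding decomposed_def by blast+
    have "\<exists>x. lex_max (msupp (p l i)) x" for i
    proof (rule lex_max_exists)
      show "finite (msupp (p l i))" using sub finite_P finite_subset by metis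
      show "msupp (p l i) \<noteq> {}" using sum True by (intro msupp_nonempty_if_sum_pos[where A = "set_pmf (P i)"]) auto
    qed
    then obtain q where q: "\<And>i. lex_max (msupp (p l i)) (q i)" by metis
    have "l \<le> r" "0 < d l" using True by auto
    then show False
      using algorithm2_step.split[where l = l and p = p and q = q, OF _ _ q refl refl] stuck unfolding Splitting by blast
  qed
  then show ?thesis ..
qed blast

end

section \<open>Running the algorithm on a vertex of the linear program\<close>

theorem theorem3:
  fixes P :: "'n::finite \<Rightarrow> ('d::{finite,linorder} point) pmf"
    and lam :: "'n \<Rightarrow> real"
    and Pbar :: "('d point) measure"
    and Porg :: "('d point) pmf"
    and y :: "'n \<times> 'd point \<times> 'd point \<Rightarrow>\<^sub>0 real"
    and s :: "nat \<Rightarrow> 'd point"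
    and r :: nat
  assumes discrete: "\<And>i. finite (set_pmf (P i))"
    and lam_pos: "\<And>i. 0 < lam i"
    and lam_sum: "(\<Sum>i\<in>UNIV. lam i) = 1"
    and bary: "barycenter P lam Pbar"
    and alg1: "algorithm1_output (S_org P) P lam Porg y"
    and enum: "bij_betw s {1..r} (set_pmf Porg)"
  shows
    "\<not> (\<exists>run. run 0 = algorithm2_start s r Porg y \<and>
              (\<forall>n. algorithm2_step lam s r (run n) (run (Suc n)))) \<and>
     (\<forall>c. (algorithm2_step lam s r)\<^sup>*\<^sup>* (algorithm2_start s r Porg y) c \<and>
          \<not> (\<exists>c'. algorithm2_step lam s r c c') \<longrightarrow>
          (\<exists>P'. c = Returned (pmf P') \<and>
                set_pmf P' \<subseteq> S_centers P lam \<and>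
                phi P lam (borel_pmf P') \<le> 2 * phi P lam Pbar \<and>
                (\<exists>y'. transport P' P y' \<and> non_mass_splitting P' P y' \<and>
                      transport_cost (set_pmf P') P lam y' \<le> 2 * phi P lam Pbar) \<and>
                int (card (set_pmf P')) \<le>
                  ((\<Sum>i\<in>UNIV. int (card (set_pmf (P i)))) - int CARD('n) + 1)\<^sup>2))"
proof -
  define C where "C = lp_cost (S_org P) P lam y"
  define K where "K = (\<Sum>i\<in>UNIV. int (card (set_pmf (P i)))) - int CARD('n) + 1"
  define p where "p k i w = Poly_Mapping.lookup y (i, s k, w)" for k i w
  have finS: "finite (S_org P)" using discrete by (simp add: S_org_def)
  have C_le: "C \<le> 2 * phi P lam Pbar"
    unfolding C_def using bary lam_pos
    by (intro lp_cost_le_two_phi[OF alg1 discrete _ lam_sum]) (auto simp: barycenter_def less_imp_le)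
  obtain z where z: "(z, y) extreme_point_of lp_feasible (S_org P) P"
    and Porg: "\<And>x. pmf Porg x = Poly_Mapping.lookup z x"
    using alg1 by (auto simp: algorithm1_output_def)
  have "(z, y) \<in> lp_feasible (S_org P) P" using z by (simp add: extreme_point_of_def)
  note F = this[unfolded lp_feasible_iff]
  have keys: "Poly_Mapping.keys z = set_pmf Porg"
    by (auto simp: in_keys_iff set_pmf_iff Porg)
  have inj: "inj_on s {1..r}" and range_s: "s ` {1..r} = set_pmf Porg"
    using enum by (auto simp: bij_betw_def)
  have r_le: "int r \<le> K"
    using lp_vertex_card_support[OF finS discrete z] bij_betw_same_card[OF enum]
    by (simp add: keys K_def)
  have s_S: "set_pmf Porg \<subseteq> S_org P"
    using F by (auto simp: set_pmf_iff Porg)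
  \<comment> \<open>The bridge between the linear program, which sums over \<open>S_org P\<close>,
    and the run, which sums over positions \<open>1, ..., r\<close>.\<close>
  have sum_S: "(\<Sum>x\<in>S_org P. h x) = (\<Sum>k=1..r. h (s k))"
    if "\<And>x. x \<in> S_org P \<Longrightarrow> x \<notin> set_pmf Porg \<Longrightarrow> h x = 0" for h :: "'d point \<Rightarrow> real"
  proof -
    have "(\<Sum>x\<in>S_org P. h x) = (\<Sum>x\<in>set_pmf Porg. h x)"
      using finS s_S that by (intro sum.mono_neutral_right) auto
    also have "\<dots> = (\<Sum>k=1..r. h (s k))"
      unfolding range_s[symmetric] using inj by (simp add: sum.reindex)
    finally show ?thesis .
  qed
  have y_nonneg: "0 \<le> Poly_Mapping.lookup y (i, x, w)" for i x w
    using F by (cases "x \<in> S_org P \<and> w \<in> set_pmf (P i)") auto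
  have y_0: "Poly_Mapping.lookup y (i, x, w) = 0" if "x \<in> S_org P" "x \<notin> set_pmf Porg" for i x w
  proof (cases "w \<in> set_pmf (P i)")
    case True
    have "(\<Sum>w\<in>set_pmf (P i). Poly_Mapping.lookup y (i, x, w)) = Poly_Mapping.lookup z x"
      using F that(1) by blast
    also have "\<dots> = 0" using that(2) by (simp add: set_pmf_iff Porg)
    finally show ?thesis
      using True y_nonneg discrete[of i] by (simp add: sum_nonneg_eq_0_iff)
  qed (use F in auto)
  have start_feasible: "feasible_masses P r (\<lambda>k. pmf Porg (s k)) p"
    unfolding feasible_masses_def
  proof (intro conjI ballI allI impI)
    show "0 \<le> p k i x" for k i x by (simp add: p_def y_nonneg)
    show "p k i x = 0" if "x \<notin> set_pmf (P i)" for k i x using F that by (simp add: p_def)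
    show "(\<Sum>x\<in>set_pmf (P i). p k i x) = pmf Porg (s k)" if "k \<in> {1..r}" for k i
    proof -
      have "s k \<in> S_org P" using that range_s s_S by blast
      then show ?thesis using F by (simp add: p_def Porg)
    qed
    show "(\<Sum>k=1..r. p k i w) = pmf (P i) w" if "w \<in> set_pmf (P i)" for i w
    proof -
      have "(\<Sum>x\<in>S_org P. Poly_Mapping.lookup y (i, x, w)) = pmf (P i) w"
        using F that by blast
      then show ?thesis
        using sum_S[of "\<lambda>x. Poly_Mapping.lookup y (i, x, w)"] y_0 by (simp add: p_def)
    qed
  qed
  have start_cost: "masses_cost P lam s r p = C"
  proof -
    have "(\<Sum>x\<in>S_org P. \<Sum>w\<in>set_pmf (P i). (norm (x - w))\<^sup>2 * Poly_Mapping.lookup y (i, x, w)) =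
        (\<Sum>k=1..r. \<Sum>w\<in>set_pmf (P i). (norm (s k - w))\<^sup>2 * p k i w)" for i
      unfolding p_def by (rule sum_S) (simp add: y_0)
    then show ?thesis
      by (simp add: masses_cost_def C_def lp_cost_def transport_cost_def)
  qed
  interpret optimal_masses P lam s r C
  proof
    fix d p' assume feas: "feasible_masses P r d p'"
    note F' = feas[unfolded feasible_masses_def]
    \<comment> \<open>A family on positions is turned back into a plan on \<open>S_org P\<close> by
      inverting the enumeration \<open>s\<close>, with 0 off the support of \<open>Porg\<close>.
      Optimality of the vertex against this plan is what the locale demands.\<close>
    define k where "k = the_inv_into {1..r} s"
    define g where "g i x w = (if x \<in> set_pmf Porg then p' (k x) i w else 0)" for i x w
    have k_s: "k (s j) = j" if "j \<in> {1..r}" for j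
      unfolding k_def using inj that by (rule the_inv_into_f_f)
    have k_r: "k x \<in> {1..r}" if "x \<in> set_pmf Porg" for x
      using that k_s unfolding range_s[symmetric] by auto
    have g_s: "g i (s j) w = p' j i w" if "j \<in> {1..r}" for i j w
      using that range_s k_s by (auto simp: g_def)
    have "C \<le> transport_cost (S_org P) P lam g"
      unfolding C_def
    proof (rule algorithm1_optimal[OF alg1 finS discrete, where z = "\<lambda>x. if x \<in> set_pmf Porg then d (k x) else 0"])
      fix i x assume "x \<in> S_org P"
      show "(\<Sum>w\<in>set_pmf (P i). g i x w) = (if x \<in> set_pmf Porg then d (k x) else 0)"
        using F' k_r[of x] by (auto simp: g_def)
    next
      fix i w assume w: "w \<in> set_pmf (P i)"
      have "(\<Sum>x\<in>S_org P. g i x w) = (\<Sum>j=1..r. g i (s j) w)"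
        by (rule sum_S) (simp add: g_def)
      also have "\<dots> = (\<Sum>j=1..r. p' j i w)"
        by (intro sum.cong refl g_s)
      also have "\<dots> = pmf (P i) w" using F' w by blast
      finally show "(\<Sum>x\<in>S_org P. g i x w) = pmf (P i) w" .
    next
      fix i x w
      have "0 \<le> p' (k x) i w" if "x \<in> set_pmf Porg" using F' k_r[OF that] by blast
      then show "0 \<le> g i x w" by (simp add: g_def)
    qed
    also have "transport_cost (S_org P) P lam g = masses_cost P lam s r p'"
    proof -
      have "(\<Sum>x\<in>S_org P. \<Sum>w\<in>set_pmf (P i). (norm (x - w))\<^sup>2 * g i x w) =
          (\<Sum>j=1..r. \<Sum>w\<in>set_pmf (P i). (norm (s j - w))\<^sup>2 * g i (s j) w)" for i
        by (rule sum_S) (simp add: g_def)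
      then show ?thesis
        by (simp add: masses_cost_def transport_cost_def g_s)
    qed
    finally show "C \<le> masses_cost P lam s r p'" .
  qed (use discrete lam_pos lam_sum in auto)
  have start: "invariant (algorithm2_start s r Porg y)"
    using start_feasible start_cost by (auto simp: algorithm2_start_def p_def[abs_def])
  have reachable: "invariant c" if "(algorithm2_step lam s r)\<^sup>*\<^sup>* (algorithm2_start s r Porg y) c" for c
    using that by (induction rule: rtranclp_induct) (use start algorithm2_step_invariant in auto)
  have result: "\<exists>P'. c = Returned (pmf P') \<and> set_pmf P' \<subseteq> S_centers P lam \<and>
      phi P lam (borel_pmf P') \<le> 2 * phi P lam Pbar \<and>
      (\<exists>y'. transport P' P y' \<and> non_mass_splitting P' P y' \<and>
         transport_cost (set_pmf P') P lam y' \<le> 2 * phi P lam Pbar) \<and>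
      int (card (set_pmf P')) \<le> K\<^sup>2"
    if c: "(algorithm2_step lam s r)\<^sup>*\<^sup>* (algorithm2_start s r Porg y) c"
      "\<not> (\<exists>c'. algorithm2_step lam s r c c')" for c
  proof -
    obtain m where m: "c = Returned m"
      using algorithm2_stuck_returned[OF reachable[OF c(1)] c(2)] by blast
    then obtain P' y' where P': "m = pmf P'" "finite (set_pmf P')" "set_pmf P' \<subseteq> S_centers P lam"
      and y': "transport P' P y'" "non_mass_splitting P' P y'" "transport_cost (set_pmf P') P lam y' \<le> C"
      and card: "int (card (set_pmf P')) \<le> int r * K"
      using reachable[OF c(1)] unfolding m invariant.simps K_def[symmetric] by blast
    have "phi P lam (borel_pmf P') \<le> transport_cost (set_pmf P') P lam y'"
      using lam_pos by (intro phi_le_transport_cost[OF P'(2) discrete _ y'(1)]) (simp add: less_imp_le)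
    \<comment> \<open>One factor \<open>K\<close> bounds the tuples per point, the other the number
      \<open>r\<close> of points of the vertex. \<open>K\<close> is nonnegative because it is at
      least \<open>r\<close>.\<close>
    moreover have "int r * K \<le> K\<^sup>2"
      unfolding power2_eq_square using r_le by (intro mult_right_mono) auto
    ultimately show ?thesis
      using m P' y' card C_le by (intro exI[of _ P'] conjI exI[of _ y']) auto
  qed
  show ?thesis
    using algorithm2_terminates[OF start] result unfolding K_def by blast
qed

end
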